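(* Let $\widetilde p_2,\widetilde p_3:\mathbb{R}\to\mathbb{C}$ be $\pi$-periodic, locally integrable functions with $\overline{\widetilde p_j(-x)}=\widetilde p_j(x)$ for $j=2,3$, and let $\widetilde P=\begin{pmatrix}0&\widetilde p_2\\ \widetilde p_3&0\end{pmatrix}$. Let $\{\varepsilon_k\}$ be a sequence and $N$ a positive constant as described in the context. Then for every integer $k$ with $|k|>N$ the intervals $$[2k+2\varepsilon_k,\,2k+1-2\varepsilon_k]\quad\text{and}\quad[2k+1+2\varepsilon_k,\,2k+2-2\varepsilon_k]$$ belong to the spectrum $\sigma(L(\widetilde P))$ of the operator $L(\widetilde P)$. Consequently, the main part of the real axis belongs to $\sigma(L(\widetilde P))$ in the sense that $$\lim_{s\to\infty}\frac{\mu\bigl(\sigma(L(\widetilde P))\cap(-2s,2s)\bigr)}{4s}=1 .$$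
   Context: $L(\widetilde P)$ is the operator generated in $L_2^2(-\infty,\infty)$ (square-integrable $\mathbb{C}^2$-valued functions on $\mathbb{R}$) by the Dirac expression $\begin{pmatrix}-i&0\\ 0&i\end{pmatrix}\mathbf{y}'(x)+\widetilde P(x)\mathbf{y}(x)$. For $t\in[0,2)$, $L_t(\widetilde P)$ is the operator generated in $L_2^2[0,\pi]$ by the same expression and the boundary condition $\mathbf{y}(\pi)=e^{i\pi t}\mathbf{y}(0)$. It is well known that $\sigma(L(\widetilde P))=\bigcup_{t\in[0,2)}\sigma(L_t(\widetilde P))$ and that $\sigma(L_t(\widetilde P))$ consists of eigenvalues. $\mu$ denotes Lebesgue measure on $\mathbb{R}$, and $(-2s,2s)$ is a real interval. The function $f$: let $E(x,\lambda)=(e_{ij}(x,\lambda))_{i,j=1}^2$ be the fundamental matrix of $\begin{pmatrix}-i&0\\ 0&i\end{pmatrix}\mathbf{y}'+\widetilde P\mathbf{y}=\lambda\mathbf{y}$ with $E(0,\lambda)=I$. The eigenvalues of $L_t(\widetilde P)$ are the roots of $\Delta(\lambda,t)=\det(E(\pi,\lambda)-e^{i\pi t}I)=0$, and $\Delta(\lambda,t)=e^{i2\pi t}-2e^{i\pi t}\cos\pi\lambda+1+o(1)$ as $\lambda\to\infty$ in a strip $|\operatorname{Im}\lambda|<a$ ($a$ fixed). Accordingly, the eigenvalues of $L_t(\widetilde P)$ in this strip are the roots of $\cos\pi\lambda-\cos\pi t+e^{-i\pi t}f(\lambda)=0$, where $f$ is an entire function with $f(\lambda)\to0$ as $\lambda\to\infty$,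 $|\operatorname{Im}\lambda|<a$. The sequence $\{\varepsilon_k\}$: $\{\varepsilon_k\}$ and $\{\delta_k\}$ ($k\in\mathbb{Z}$) are sequences of positive numbers with $\varepsilon_k\to0$, $\delta_k\to0$ as $|k|\to\infty$ such that, for all $|k|$ sufficiently large, $\frac92\varepsilon_k^2>\delta_k$ and $|f(\lambda)|<\delta_k$ for all $\lambda$ with $\operatorname{Re}\lambda\in[2k,2k+2]$, $|\operatorname{Im}\lambda|\le\varepsilon_k$. The constant $N$: a positive constant such that for every integer $k$ with $|k|>N$ and every $t\in T(k):=[\varepsilon_k,1-\varepsilon_k]\cup[1+\varepsilon_k,2-\varepsilon_k]$, the operator $L_t(\widetilde P)$ has a unique eigenvalue, counting multiplicities, inside each of the circles $C(2k+t,\varepsilon_k)$ and $C(2k-t,\varepsilon_k)$, where $C(c,\varepsilon)=\{\mu\in\mathbb{C}:|\mu-c|=\varepsilon\}$. *)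

theory Defs
  imports "HOL-Analysis.Analysis" "HOL-Library.Function_Algebras"
begin

subsection \<open>Square-integrable vector functions and operators on them\<close>

text \<open>
  An unbounded operator on the space of square-integrable functions on \<open>I\<close> with values in
  \<open>complex ^ 2\<close> is represented by its graph, a set of pairs of functions.  A member of the domain
  is represented by its unique continuous representative, extended by zero outside \<open>I\<close> (so that
  distinct functions in the domain are distinct elements of the Hilbert space); the second
  component of a pair is only determined almost everywhere on \<open>I\<close>.
\<close>

type_synonym vfun = "real \<Rightarrow> complex ^ 2"

definition square_integrable :: "real set \<Rightarrow> vfun \<Rightarrow> bool" where
  "square_integrable I y \<longleftrightarrow>
     y \<in> borel_measurable (lebesgue_on I) \<and> integrable (lebesgue_on I) (\<lambda>x. (norm (y x))\<^sup>2)"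

definition L2norm :: "real set \<Rightarrow> vfun \<Rightarrow> real" where
  "L2norm I y = sqrt (\<integral>x. (norm (y x))\<^sup>2 \<partial>lebesgue_on I)"

definition cscale :: "complex \<Rightarrow> vfun \<Rightarrow> vfun" where
  "cscale c y = (\<lambda>x. c *s y x)"

lemma vector_space_cscale: "vector_space cscale"
  by unfold_locales
    (auto simp: cscale_def fun_eq_iff vec_eq_iff algebra_simps)

definition eigenvalue :: "(vfun \<times> vfun) set \<Rightarrow> complex \<Rightarrow> bool" where
  "eigenvalue A z \<longleftrightarrow> (\<exists>y. y \<noteq> 0 \<and> (y, cscale z y) \<in> A)"

text \<open>\<open>ker_pow A z n\<close> is the kernel of the \<open>n\<close>-th power of \<open>A - z\<close>.\<close>

primrec ker_pow :: "(vfun \<times> vfun) set \<Rightarrow> complex \<Rightarrow> nat \<Rightarrow> vfun set" where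
  "ker_pow A z 0 = {0}"
| "ker_pow A z (Suc n) = {y. \<exists>w \<in> ker_pow A z n. (y, cscale z y + w) \<in> A}"

definition alg_multiplicity :: "(vfun \<times> vfun) set \<Rightarrow> complex \<Rightarrow> nat" where
  "alg_multiplicity A z = vector_space.dim cscale (\<Union>n. ker_pow A z n)"

definition unique_simple_eigenvalue_in :: "(vfun \<times> vfun) set \<Rightarrow> complex set \<Rightarrow> bool" where
  "unique_simple_eigenvalue_in A D \<longleftrightarrow>
     (\<exists>z. {w \<in> D. eigenvalue A w} = {z} \<and> alg_multiplicity A z = 1)"

definition resolvent_set :: "real set \<Rightarrow> (vfun \<times> vfun) set \<Rightarrow> complex set" where
  "resolvent_set I A =
     {z. (\<forall>g. square_integrable I g \<longrightarrow>
            (\<exists>!y. \<exists>h. (y, h) \<in> A \<and> (AE x in lebesgue_on I. h x - z *s y x = g x))) \<and>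
         (\<exists>C. \<forall>(y, h) \<in> A. L2norm I y \<le> C * L2norm I (h - cscale z y))}"

definition spectrum :: "real set \<Rightarrow> (vfun \<times> vfun) set \<Rightarrow> complex set" where
  "spectrum I A = - resolvent_set I A"


subsection \<open>Dirac operators\<close>

text \<open>
  \<open>y\<close> is absolutely continuous on every compact subinterval of \<open>I\<close>, with derivative \<open>g\<close> almost
  everywhere, expressed through the fundamental theorem of calculus for the Lebesgue integral.
\<close>

definition ac_deriv_on :: "real set \<Rightarrow> vfun \<Rightarrow> vfun \<Rightarrow> bool" where
  "ac_deriv_on I y g \<longleftrightarrow>
     (\<forall>a b. a \<le> b \<and> {a..b} \<subseteq> I \<longrightarrow>
        g absolutely_integrable_on {a..b} \<and> y b - y a = integral {a..b} g)"

definition locally_integrable :: "(real \<Rightarrow> complex) \<Rightarrow> bool" where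
  "locally_integrable p \<longleftrightarrow> (\<forall>a b. p absolutely_integrable_on {a..b})"

definition Jmat :: "complex ^ 2 ^ 2" where
  "Jmat = vector [vector [- \<i>, 0], vector [0, \<i>]]"

definition Pmat :: "(real \<Rightarrow> complex) \<Rightarrow> (real \<Rightarrow> complex) \<Rightarrow> real \<Rightarrow> complex ^ 2 ^ 2" where
  "Pmat p2 p3 x = vector [vector [0, p2 x], vector [p3 x, 0]]"

text \<open>\<open>dirac_expr I P y h\<close>: the Dirac expression is applicable to \<open>y\<close> on \<open>I\<close> and yields \<open>h\<close>.\<close>

definition dirac_expr :: "real set \<Rightarrow> (real \<Rightarrow> complex ^ 2 ^ 2) \<Rightarrow> vfun \<Rightarrow> vfun \<Rightarrow> bool" where
  "dirac_expr I P y h \<longleftrightarrow>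
     (\<exists>g. ac_deriv_on I y g \<and> (AE x in lebesgue_on I. h x = Jmat *v g x + P x *v y x))"

text \<open>The maximal operator generated by the Dirac expression on \<open>I\<close>.\<close>

definition dirac_op :: "real set \<Rightarrow> (real \<Rightarrow> complex ^ 2 ^ 2) \<Rightarrow> (vfun \<times> vfun) set" where
  "dirac_op I P =
     {(y, h). square_integrable I y \<and> square_integrable I h \<and> (\<forall>x. x \<notin> I \<longrightarrow> y x = 0) \<and>
              dirac_expr I P y h}"

definition dirac_L :: "(real \<Rightarrow> complex ^ 2 ^ 2) \<Rightarrow> (vfun \<times> vfun) set" where
  "dirac_L P = dirac_op UNIV P"

definition dirac_Lt :: "real \<Rightarrow> (real \<Rightarrow> complex ^ 2 ^ 2) \<Rightarrow> (vfun \<times> vfun) set" where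
  "dirac_Lt t P = {(y, h) \<in> dirac_op {0..pi} P. y pi = exp (\<i> * of_real (pi * t)) *s y 0}"

definition fundamental_matrix ::
    "(real \<Rightarrow> complex ^ 2 ^ 2) \<Rightarrow> (real \<Rightarrow> complex \<Rightarrow> complex ^ 2 ^ 2) \<Rightarrow> bool" where
  "fundamental_matrix P E \<longleftrightarrow>
     (\<forall>z. E 0 z = mat 1 \<and>
        (\<forall>j. dirac_expr UNIV P (\<lambda>x. column j (E x z)) (\<lambda>x. z *s column j (E x z))))"

definition char_det :: "(real \<Rightarrow> complex \<Rightarrow> complex ^ 2 ^ 2) \<Rightarrow> complex \<Rightarrow> real \<Rightarrow> complex" where
  "char_det E z t = det (E pi z - mat (exp (\<i> * of_real (pi * t))))"

text \<open>
  The remainder \<open>f\<close> is \<open>-1/2\<close> times the difference between the characteristic determinant and its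
  leading part; the normalization is the one that gives \<open>char_det_eq_0_iff\<close> below.
  It depends on \<open>t\<close> through a factor of modulus one only (the determinant of \<open>E pi z\<close> is 1).
\<close>

definition remainder_f :: "(real \<Rightarrow> complex \<Rightarrow> complex ^ 2 ^ 2) \<Rightarrow> real \<Rightarrow> complex \<Rightarrow> complex" where
  "remainder_f E t z =
     - (char_det E z t
        - (exp (\<i> * of_real (2 * pi * t)) - 2 * exp (\<i> * of_real (pi * t)) * cos (of_real pi * z) + 1)) / 2"

lemma char_det_eq_0_iff:
  "char_det E z t = 0 \<longleftrightarrow>
     cos (of_real pi * z) - cos (of_real (pi * t)) + exp (- \<i> * of_real (pi * t)) * remainder_f E t z = 0"
proof -
  define u where "u = exp (\<i> * of_real (pi * t))"
  define v where "v = exp (- \<i> * of_real (pi * t))"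
  have uv: "u * v = 1"
    by (simp add: u_def v_def flip: exp_add)
  have u2: "exp (\<i> * of_real (2 * pi * t)) = u * u"
    by (simp add: u_def algebra_simps flip: exp_add)
  have c: "cos (of_real (pi * t) :: complex) = (u + v) / 2"
    by (simp add: cos_exp_eq u_def v_def)
  have "- 2 * u * (cos (of_real pi * z) - (u + v) / 2 + v * remainder_f E t z) =
        - 2 * u * cos (of_real pi * z) + u * u + u * v - 2 * (u * v) * remainder_f E t z"
    by (simp add: field_simps)
  also have "\<dots> = char_det E z t"
    by (simp only: uv, simp only: remainder_f_def u2 u_def[symmetric], simp add: field_simps)
  finally show ?thesis
    using uv unfolding c v_def[symmetric] by (metis mult_eq_0_iff mult_zero_right mult_zero_left
        neg_equal_0_iff_equal zero_neq_numeral zero_neq_one)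
qed

end

theory Submission
  imports Defs
begin

text \<open>
  Let \<open>F z\<close> be the trace of the monodromy matrix \<open>E pi z\<close>.  The Wronskian gives
  \<open>det (E pi z) = 1\<close>, so the multipliers \<open>\<rho>\<close> of the equation satisfy \<open>\<rho> + 1 / \<rho> = F z\<close>, and
  \<open>z\<close> is an eigenvalue of \<open>L\<^sub>t\<close> exactly when \<open>F z = 2 cos (\<pi> t)\<close>
  (\<open>eigenvalue_iff_discr\<close>).  The symmetry \<open>cnj (p (- x)) = p x\<close> turns a solution \<open>y\<close> for \<open>z\<close>
  into the solution \<open>x \<mapsto> cnj (y (- x))\<close> for \<open>cnj z\<close>, so \<open>E pi (cnj z)\<close> is the complex conjugate of
  the inverse of \<open>E pi z\<close>.  A two by two matrix of determinant one has the same trace as its inverse,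
  whence \<open>F (cnj z) = cnj (F z)\<close> (\<open>discr_cnj\<close>).  Consequently \<open>F\<close> is real on the real axis, and an eigenvalue of \<open>L\<^sub>t\<close> that is
  alone in a disc with real centre is its own conjugate, hence real.

  The rest of the first claim is real analysis of the continuous function \<open>F\<close> on the line.  For
  each \<open>t\<close> in \<open>[\<epsilon>, 1 - \<epsilon>]\<close> the level \<open>2 cos (\<pi> t)\<close> is attained exactly once in
  \<open>(2k + t - \<epsilon>, 2k + t + \<epsilon>)\<close>.  Uniqueness prevents \<open>F\<close> from touching a level without crossing
  it, since a slightly different level would then be attained twice; so the point where the level is
  attained moves continuously with \<open>t\<close>, from below \<open>2k + 2\<epsilon>\<close> to above \<open>2k + 1 - 2\<epsilon>\<close>, and
  sweeps over everything between (\<open>unique_level_point_bound\<close> is a quantitative form of this).  The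
  interval \<open>[1 + \<epsilon>, 2 - \<epsilon>]\<close>, on which the levels increase, gives the second band.  On the bands
  \<open>\<bar>F\<bar> \<le> 2\<close>, so there is a multiplier of modulus one and with it a solution whose norm stays between
  two positive constants on a half line.  Cut off by long tents it violates every bound on the
  resolvent, which places the point in the spectrum of \<open>L\<close> (\<open>bloch_solution_spectrum\<close>).

  For the density statement the gaps left in \<open>[2k, 2k + 2]\<close> have total length at most \<open>8 \<epsilon> k\<close>,
  which tends to zero, so they are negligible in the mean (\<open>density_one_of_shrinking_gaps\<close>).  The
  measure of the spectrum must make sense for this, and it does because the spectrum is closed
  (\<open>spectrum_closed\<close>): near a point of the resolvent set the equation is solved by a Neumann series,
  which converges pointwise as well as in the mean because a function in the domain of \<open>L\<close> is
  controlled on bounded intervals by its graph norm (\<open>L_pointwise_bound\<close>).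

  The coefficients are merely locally integrable, so derivatives exist only in the sense of Lebesgue
  primitives.  Two facts about these carry all arguments with the differential equation: the product
  rule and an inequality of Gronwall type.
\<close>

section \<open>Lebesgue primitives\<close>

text \<open>
  This is the relation \<open>ac_deriv_on\<close> for values in an arbitrary Euclidean space.  The extra
  generality is what makes a product rule possible: there the factors and the product are scalars
  and vectors in varying combinations.
\<close>

definition primitive_on :: "real set \<Rightarrow> (real \<Rightarrow> 'a::euclidean_space) \<Rightarrow> (real \<Rightarrow> 'a) \<Rightarrow> bool" where
  "primitive_on I u f \<longleftrightarrow>
     (\<forall>a b. a \<le> b \<and> {a..b} \<subseteq> I \<longrightarrow>
        f absolutely_integrable_on {a..b} \<and> (f has_integral (u b - u a)) {a..b})"

lemma ac_deriv_on_iff_primitive_on: "ac_deriv_on I y g \<longleftrightarrow> primitive_on I y g"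
  unfolding ac_deriv_on_def primitive_on_def
  by (metis absolutely_integrable_on_def has_integral_integral integral_unique)

lemma primitive_onD:
  assumes "primitive_on I u f" "a \<le> b" "{a..b} \<subseteq> I"
  shows "f absolutely_integrable_on {a..b}" "(f has_integral (u b - u a)) {a..b}"
  using assms unfolding primitive_on_def by auto

lemma primitive_on_subset: "primitive_on I u f \<Longrightarrow> J \<subseteq> I \<Longrightarrow> primitive_on J u f"
  unfolding primitive_on_def by (meson subset_trans)

lemma primitive_on_add:
  "primitive_on I u f \<Longrightarrow> primitive_on I v g \<Longrightarrow> primitive_on I (\<lambda>x. u x + v x) (\<lambda>x. f x + g x)"
  unfolding primitive_on_def
  by (auto simp: add_diff_add intro!: has_integral_add set_integral_add)

lemma primitive_on_bounded_linear:
  assumes "bounded_linear h" "primitive_on I u f"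
  shows "primitive_on I (\<lambda>x. h (u x)) (\<lambda>x. h (f x))"
proof -
  interpret bounded_linear h by fact
  show ?thesis
    using assms(2) has_integral_linear[OF _ assms(1)] absolutely_integrable_linear[OF _ assms(1)]
    unfolding primitive_on_def o_def by (metis diff)
qed

lemma primitive_on_shift:
  assumes "primitive_on UNIV u f"
  shows "primitive_on UNIV (\<lambda>x. u (x + c)) (\<lambda>x. f (x + c))"
  unfolding primitive_on_def
proof safe
  fix a b :: real assume ab: "a \<le> b"
  have i: "f absolutely_integrable_on {a+c..b+c}" "(f has_integral (u (b+c) - u (a+c))) {a+c..b+c}"
    using primitive_onD[OF assms, of "a+c" "b+c"] ab by auto
  show "((\<lambda>x. f (x + c)) has_integral u (b + c) - u (a + c)) {a..b}"
    using has_integral_shift_real_ivl[OF i(2), of c] by simp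
  have "(\<lambda>x. norm (f x)) integrable_on {a+c..b+c}"
    using i(1) by (simp add: absolutely_integrable_on_def)
  then have "(\<lambda>x. norm (f (x + c))) integrable_on {a..b}"
    using integrable_shift_real_ivl[of "\<lambda>x. norm (f x)" "a+c" "b+c" c] by simp
  with \<open>((\<lambda>x. f (x + c)) has_integral u (b + c) - u (a + c)) {a..b}\<close>
  show "(\<lambda>x. f (x + c)) absolutely_integrable_on {a..b}"
    unfolding absolutely_integrable_on_def by blast
qed

lemma primitive_on_reflect:
  assumes "primitive_on UNIV u f"
  shows "primitive_on UNIV (\<lambda>x. u (- x)) (\<lambda>x. - f (- x))"
  unfolding primitive_on_def
proof safe
  fix a b :: real assume ab: "a \<le> b"
  have i: "f absolutely_integrable_on {-b..-a}" "(f has_integral (u (-a) - u (-b))) {-b..-a}"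
    using primitive_onD[OF assms, of "-b" "-a"] ab by auto
  show "((\<lambda>x. - f (- x)) has_integral u (- b) - u (- a)) {a..b}"
    using has_integral_neg[OF has_integral_reflect_lemma_real[OF i(2)]] by simp
  have "(\<lambda>x. f (- x)) absolutely_integrable_on {a..b}"
    using i(1) absolutely_integrable_reflect_real[where f=f and a="-b" and b="-a"] by simp
  then show "(\<lambda>x. - f (- x)) absolutely_integrable_on {a..b}"
    unfolding absolutely_integrable_on_def by (simp add: integrable_neg)
qed

lemma primitive_on_spike:
  assumes "primitive_on I u f" "negligible N" "\<And>x. x \<in> I - N \<Longrightarrow> g x = f x"
  shows "primitive_on I u g"
  unfolding primitive_on_def
proof (intro allI impI conjI)
  fix a b assume ab: "a \<le> b \<and> {a..b} \<subseteq> I"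
  note i = primitive_onD[OF assms(1) ab[THEN conjunct1] ab[THEN conjunct2]]
  show "g absolutely_integrable_on {a..b}"
    by (rule absolutely_integrable_spike[OF i(1) assms(2)]) (use ab assms(3) in auto)
  show "(g has_integral u b - u a) {a..b}"
    by (rule has_integral_spike[OF assms(2) _ i(2)]) (use ab assms(3) in auto)
qed

lemma primitive_on_cong:
  assumes "primitive_on I u f" "\<And>x. x \<in> I \<Longrightarrow> v x = u x" "\<And>x. x \<in> I \<Longrightarrow> g x = f x"
  shows "primitive_on I v g"
proof -
  have "primitive_on I u g" by (rule primitive_on_spike[OF assms(1), of "{}"]) (use assms in auto)
  then show ?thesis unfolding primitive_on_def using assms(2)
    by (smt (verit, best) atLeastAtMost_iff subset_iff)
qed

lemma primitive_on_continuous: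
  assumes "primitive_on {a..b} u f"
  shows "continuous_on {a..b} u"
proof (cases "a \<le> b")
  case True
  have "f integrable_on {a..b}"
    using primitive_onD(2)[OF assms True] by (auto simp: integrable_on_def)
  then have "continuous_on {a..b} (\<lambda>x. u a + integral {a..x} f)"
    by (intro continuous_intros indefinite_integral_continuous_1)
  moreover have "u a + integral {a..x} f = u x" if "x \<in> {a..b}" for x
    using primitive_onD(2)[OF assms, of a x] that by (auto simp: integral_unique)
  ultimately show ?thesis by (rule continuous_on_eq)
qed auto

lemma absolutely_integrable_bilinear_continuous:
  fixes prod :: "'a::euclidean_space \<Rightarrow> 'b::euclidean_space \<Rightarrow> 'c::euclidean_space"
  assumes "bounded_bilinear prod" "f absolutely_integrable_on {a..b}" "continuous_on {a..b} v"
  shows "(\<lambda>x::real. prod (f x) (v x)) absolutely_integrable_on {a..b}"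
proof -
  show ?thesis
  proof (rule absolutely_integrable_bounded_measurable_product[where h = "\<lambda>p q. prod q p" and f = v])
    show "bilinear (\<lambda>p q. prod q p)"
      using bounded_bilinear.flip[OF assms(1)] by (simp add: bilinear_conv_bounded_bilinear)
    show "v \<in> borel_measurable (lebesgue_on {a..b})"
      using assms(3) by (intro continuous_imp_measurable_on_sets_lebesgue) auto
    show "bounded (v ` {a..b})"
      by (intro compact_imp_bounded compact_continuous_image assms) auto
  qed (use assms in auto)
qed

text \<open>
  On a short interval \<open>[c, d]\<close> around a point the increment of the product is
  \<open>prod (u d - u c) (v d) + prod (u c) (v d - v c)\<close>, which differs from the integral of the claimed
  derivative by at most the oscillation of \<open>u\<close> and \<open>v\<close> times the integral of \<open>norm f + norm g\<close>.  The
  defect is additive over adjacent intervals, so a bisection argument turns the local estimate into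
  the bound \<open>e * \<integral> (norm f + norm g)\<close> on the whole interval, for every \<open>e > 0\<close>.
\<close>
lemma primitive_on_product:
  fixes prod :: "'a::euclidean_space \<Rightarrow> 'b::euclidean_space \<Rightarrow> 'c::euclidean_space"
  assumes bb: "bounded_bilinear prod"
    and u: "primitive_on I u f" and v: "primitive_on I v g"
  shows "primitive_on I (\<lambda>x. prod (u x) (v x)) (\<lambda>x. prod (f x) (v x) + prod (u x) (g x))"
  unfolding primitive_on_def
proof (intro allI impI)
  interpret bounded_bilinear prod by fact
  fix a b assume ab: "a \<le> b \<and> {a..b} \<subseteq> I"
  let ?q = "\<lambda>x. prod (f x) (v x) + prod (u x) (g x)"
  have u': "primitive_on {a..b} u f" and v': "primitive_on {a..b} v g"
    using u v ab by (auto intro: primitive_on_subset)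
  have cu: "continuous_on {a..b} u" and cv: "continuous_on {a..b} v"
    using u' v' primitive_on_continuous by auto
  have fa: "f absolutely_integrable_on {a..b}" and ga: "g absolutely_integrable_on {a..b}"
    using primitive_onD(1)[OF u'] primitive_onD(1)[OF v'] ab by auto
  have q: "?q absolutely_integrable_on {a..b}"
    using absolutely_integrable_bilinear_continuous[OF bb fa cv]
      absolutely_integrable_bilinear_continuous[OF flip ga cu]
    by (intro set_integral_add) auto
  have qi: "?q integrable_on {a..b}" using q by (simp add: absolutely_integrable_on_def)
  define w where "w x = norm (f x) + norm (g x)" for x
  have wi: "w integrable_on {a..b}"
    unfolding w_def using fa ga by (intro integrable_add) (auto simp: absolutely_integrable_on_def)
  have sub: "F integrable_on {c..d}" if "F integrable_on {a..b}" "a \<le> c" "d \<le> b"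
    for F :: "real \<Rightarrow> 'z::euclidean_space" and c d
    using that integrable_on_subinterval by fastforce
  obtain K where K: "K > 0" "\<And>p r. norm (prod p r) \<le> norm p * norm r * K"
    using pos_bounded by auto
  define D where "D c d = prod (u d) (v d) - prod (u c) (v c) - integral {c..d} ?q" for c d
  have est: "norm (D a b) \<le> e * integral {a..b} w" if e: "e > 0" for e
  proof -
    define P where "P c d \<longleftrightarrow> (a \<le> c \<and> c \<le> d \<and> d \<le> b \<longrightarrow> norm (D c d) \<le> e * integral {c..d} w)" for c d
    have "P a b"
    proof (rule Bolzano[OF ab[THEN conjunct1]])
      fix c d e' assume P: "P c d" "P d e'" "c \<le> d" "d \<le> e'"
      show "P c e'"
        unfolding P_def
      proof
        assume *: "a \<le> c \<and> c \<le> e' \<and> e' \<le> b"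
        have "integral {c..e'} ?q = integral {c..d} ?q + integral {d..e'} ?q"
          using P * by (intro Henstock_Kurzweil_Integration.integral_combine[symmetric] sub[OF qi]) auto
        moreover have "integral {c..e'} w = integral {c..d} w + integral {d..e'} w"
          using P * by (intro Henstock_Kurzweil_Integration.integral_combine[symmetric] sub[OF wi]) auto
        ultimately have "D c e' = D c d + D d e'"
          and "e * integral {c..e'} w = e * integral {c..d} w + e * integral {d..e'} w"
          by (auto simp: D_def algebra_simps)
        moreover have "norm (D c d) \<le> e * integral {c..d} w" "norm (D d e') \<le> e * integral {d..e'} w"
          using P * unfolding P_def by auto
        ultimately show "norm (D c e') \<le> e * integral {c..e'} w"
          using norm_triangle_ineq[of "D c d" "D d e'"] by (metis add_mono order_trans)
      qed
    next
      fix x assume x: "a \<le> x" "x \<le> b"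
      define \<eta> where "\<eta> = e / (2 * K)"
      have \<eta>: "\<eta> > 0" using e K by (simp add: \<eta>_def)
      obtain d1 where d1: "d1 > 0" "\<And>y. y \<in> {a..b} \<Longrightarrow> dist y x < d1 \<Longrightarrow> dist (u y) (u x) < \<eta>"
        using cu x \<eta> unfolding continuous_on_iff by (metis atLeastAtMost_iff)
      obtain d2 where d2: "d2 > 0" "\<And>y. y \<in> {a..b} \<Longrightarrow> dist y x < d2 \<Longrightarrow> dist (v y) (v x) < \<eta>"
        using cv x \<eta> unfolding continuous_on_iff by (metis atLeastAtMost_iff)
      show "\<exists>\<delta>>0. \<forall>c d. c \<le> x \<and> x \<le> d \<and> d - c < \<delta> \<longrightarrow> P c d"
      proof (intro exI conjI allI impI)
        show "min d1 d2 > 0" using d1 d2 by simp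
        fix c d assume cd: "c \<le> x \<and> x \<le> d \<and> d - c < min d1 d2"
        show "P c d" unfolding P_def
        proof
          assume abcd: "a \<le> c \<and> c \<le> d \<and> d \<le> b"
          have cl: "norm (u c - u s) \<le> 2 * \<eta>" "norm (v d - v s) \<le> 2 * \<eta>" if "s \<in> {c..d}" for s
          proof -
            have "dist (u c) (u x) < \<eta>" "dist (u s) (u x) < \<eta>" "dist (v d) (v x) < \<eta>" "dist (v s) (v x) < \<eta>"
              using that cd abcd by (auto intro!: d1 d2 simp: dist_real_def)
            then show "norm (u c - u s) \<le> 2 * \<eta>" "norm (v d - v s) \<le> 2 * \<eta>"
              using dist_triangle2[of "u c" "u s" "u x"] dist_triangle2[of "v d" "v s" "v x"]
              by (auto simp: dist_norm)
          qed
          have iu: "(f has_integral (u d - u c)) {c..d}" and iv: "(g has_integral (v d - v c)) {c..d}"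
            using primitive_onD(2)[OF u', of c d] primitive_onD(2)[OF v', of c d] abcd by auto
          have 1: "((\<lambda>s. prod (f s) (v d)) has_integral prod (u d - u c) (v d)) {c..d}"
            using has_integral_linear[OF iu bounded_linear_left] by (simp add: o_def)
          have 2: "((\<lambda>s. prod (u c) (g s)) has_integral prod (u c) (v d - v c)) {c..d}"
            using has_integral_linear[OF iv bounded_linear_right] by (simp add: o_def)
          have 3: "(?q has_integral integral {c..d} ?q) {c..d}"
            using sub[OF qi] abcd by (simp add: integrable_integral)
          have "((\<lambda>s. prod (f s) (v d) + prod (u c) (g s) - ?q s) has_integral D c d) {c..d}"
            using has_integral_diff[OF has_integral_add[OF 1 2] 3]
            by (simp add: D_def diff_left diff_right)
          then have 4: "((\<lambda>s. prod (f s) (v d - v s) + prod (u c - u s) (g s)) has_integral D c d) {c..d}"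
            by (simp add: diff_left diff_right algebra_simps)
          have "norm (integral {c..d} (\<lambda>s. prod (f s) (v d - v s) + prod (u c - u s) (g s)))
              \<le> integral {c..d} (\<lambda>s. e * w s)"
          proof (rule Henstock_Kurzweil_Integration.integral_norm_bound_integral)
            show "(\<lambda>s. e * w s) integrable_on {c..d}"
              using sub[OF wi] abcd by (auto intro: integrable_on_mult_right)
            fix s assume s: "s \<in> {c..d}"
            have "norm (prod (f s) (v d - v s)) \<le> norm (f s) * (2 * \<eta>) * K"
              by (rule order_trans[OF K(2)]) (use K cl(2)[OF s] in \<open>auto intro!: mult_right_mono mult_left_mono\<close>)
            moreover have "norm (prod (u c - u s) (g s)) \<le> (2 * \<eta>) * norm (g s) * K"
              by (rule order_trans[OF K(2)]) (use K cl(1)[OF s] in \<open>auto intro!: mult_right_mono\<close>)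
            moreover have "norm (f s) * (2 * \<eta>) * K + (2 * \<eta>) * norm (g s) * K = e * w s"
              using K by (simp add: \<eta>_def w_def field_simps)
            ultimately show "norm (prod (f s) (v d - v s) + prod (u c - u s) (g s)) \<le> e * w s"
              using norm_triangle_ineq[of "prod (f s) (v d - v s)" "prod (u c - u s) (g s)"] by linarith
          qed (use 4 in blast)
          then show "norm (D c d) \<le> e * integral {c..d} w"
            using 4 by (simp add: integral_unique)
        qed
      qed
    qed
    then show ?thesis using ab unfolding P_def by auto
  qed
  have "norm (D a b) \<le> 0"
  proof (rule field_le_epsilon)
    fix e :: real assume "e > 0"
    define W where "W = integral {a..b} w"
    have W0: "W \<ge> 0" unfolding W_def
      by (rule Henstock_Kurzweil_Integration.integral_nonneg[OF wi]) (simp add: w_def)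
    have "norm (D a b) \<le> e / (W + 1) * W"
      using est[of "e / (W + 1)"] \<open>e > 0\<close> W0 by (simp add: W_def)
    also have "\<dots> \<le> e" using W0 \<open>e > 0\<close> by (simp add: field_simps)
    finally show "norm (D a b) \<le> 0 + e" by simp
  qed
  then have "integral {a..b} ?q = prod (u b) (v b) - prod (u a) (v a)"
    by (simp add: D_def)
  then show "?q absolutely_integrable_on {a..b} \<and>
      (?q has_integral (prod (u b) (v b) - prod (u a) (v a))) {a..b}"
    using q qi by (metis integrable_integral)
qed

text \<open>
  The bound \<open>norm (u d) \<le> (norm (u c) + M c d) * exp (2 * K c d)\<close>, with \<open>K\<close> and \<open>M\<close> the integrals of
  \<open>k\<close> and \<open>m\<close>, is inherited by a union of adjacent intervals, so that it is enough to have it on short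
  ones.  If \<open>K c d \<le> 1 / 2\<close>, the maximum \<open>s\<close> of \<open>norm u\<close> satisfies \<open>s \<le> norm (u c) + M c d + K c d * s\<close>
  and \<open>1 / (1 - K) \<le> exp (2 * K)\<close>; this last estimate is the origin of the factor \<open>2\<close> in the exponent.
\<close>
lemma gronwall:
  assumes ab: "a \<le> b" and u: "primitive_on {a..b} u g"
    and ki: "k integrable_on {a..b}" and mi: "m integrable_on {a..b}"
    and k0: "\<And>x. x \<in> {a..b} \<Longrightarrow> 0 \<le> k x" and m0: "\<And>x. x \<in> {a..b} \<Longrightarrow> 0 \<le> m x"
    and gb: "\<And>x. x \<in> {a..b} \<Longrightarrow> norm (g x) \<le> k x * norm (u x) + m x"
  shows "norm (u b) \<le> (norm (u a) + integral {a..b} m) * exp (2 * integral {a..b} k)"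
proof -
  have sub: "F integrable_on {c..d}" if "F integrable_on {a..b}" "a \<le> c" "d \<le> b"
    for F :: "real \<Rightarrow> real" and c d
    using that integrable_on_subinterval by fastforce
  define K where "K c d = integral {c..d} k" for c d
  define M where "M c d = integral {c..d} m" for c d
  have K0: "K c d \<ge> 0" if "a \<le> c" "d \<le> b" for c d unfolding K_def
    using that by (intro Henstock_Kurzweil_Integration.integral_nonneg sub[OF ki] k0) auto
  have M0: "M c d \<ge> 0" if "a \<le> c" "d \<le> b" for c d unfolding M_def
    using that by (intro Henstock_Kurzweil_Integration.integral_nonneg sub[OF mi] m0) auto
  have cu: "continuous_on {a..b} u" using u by (rule primitive_on_continuous)
  have cK: "continuous_on {a..b} (K a)"
    unfolding K_def using ki by (rule indefinite_integral_continuous_1)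
  have KM: "K c e = K c d + K d e" "M c e = M c d + M d e" if "a \<le> c" "c \<le> d" "d \<le> e" "e \<le> b" for c d e
    unfolding K_def M_def using that
    by (auto intro!: Henstock_Kurzweil_Integration.integral_combine[symmetric] sub[OF ki] sub[OF mi])
  define P where "P c d \<longleftrightarrow> (a \<le> c \<and> c \<le> d \<and> d \<le> b \<longrightarrow>
    norm (u d) \<le> (norm (u c) + M c d) * exp (2 * K c d))" for c d
  have "P a b"
  proof (rule Bolzano[OF ab])
    fix c d e assume P: "P c d" "P d e" "c \<le> d" "d \<le> e"
    show "P c e" unfolding P_def
    proof
      assume *: "a \<le> c \<and> c \<le> e \<and> e \<le> b"
      have ord: "a \<le> c" "c \<le> d" "d \<le> e" "e \<le> b" using P * by auto
      have km: "K c e = K c d + K d e" "M c e = M c d + M d e"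
        by (rule KM[OF ord])+
      have nn: "K c d \<ge> 0" "M d e \<ge> 0" using K0[of c d] M0[of d e] ord by auto
      have "norm (u e) \<le> (norm (u d) + M d e) * exp (2 * K d e)"
        using P * by (auto simp: P_def)
      also have "\<dots> \<le> ((norm (u c) + M c d) * exp (2 * K c d) + M d e * exp (2 * K c d)) * exp (2 * K d e)"
      proof (intro mult_right_mono add_mono)
        show "norm (u d) \<le> (norm (u c) + M c d) * exp (2 * K c d)"
          using P * by (auto simp: P_def)
        show "M d e \<le> M d e * exp (2 * K c d)"
          using nn mult_left_mono[of 1 "exp (2 * K c d)" "M d e"] by simp
      qed auto
      also have "\<dots> = (norm (u c) + M c e) * exp (2 * K c e)"
        by (simp add: km distrib_left exp_add algebra_simps)
      finally show "norm (u e) \<le> (norm (u c) + M c e) * exp (2 * K c e)" .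
    qed
  next
    fix x assume x: "a \<le> x" "x \<le> b"
    have quarter: "(1/4::real) > 0" by simp
    obtain \<delta> where \<delta>: "\<delta> > 0" "\<And>y. y \<in> {a..b} \<Longrightarrow> dist y x < \<delta> \<Longrightarrow> dist (K a y) (K a x) < 1/4"
      using cK x quarter unfolding continuous_on_iff by (metis atLeastAtMost_iff)
    show "\<exists>\<delta>>0. \<forall>c d. c \<le> x \<and> x \<le> d \<and> d - c < \<delta> \<longrightarrow> P c d"
    proof (intro exI conjI allI impI)
      show "\<delta> > 0" by fact
      fix c d assume cd: "c \<le> x \<and> x \<le> d \<and> d - c < \<delta>"
      show "P c d" unfolding P_def
      proof
        assume abcd: "a \<le> c \<and> c \<le> d \<and> d \<le> b"
        have "dist (K a c) (K a x) < 1/4" "dist (K a d) (K a x) < 1/4"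
          using cd abcd by (intro \<delta>; auto simp: dist_real_def)+
        moreover have "K a d = K a c + K c d" using KM(1)[of a c d] abcd by blast
        ultimately have Ks: "K c d \<le> 1/2" unfolding dist_real_def by linarith
        have Kn: "K c d \<ge> 0" "M c d \<ge> 0" using K0[of c d] M0[of c d] abcd by auto
        have "compact {c..d}" "{c..d} \<noteq> {}" "continuous_on {c..d} (\<lambda>x. norm (u x))"
          using abcd cu by (auto intro!: continuous_intros intro: continuous_on_subset)
        then obtain p where p: "p \<in> {c..d}" "\<And>y. y \<in> {c..d} \<Longrightarrow> norm (u y) \<le> norm (u p)"
          using continuous_attains_sup by metis
        define s where "s = norm (u p)"
        have pi: "(g has_integral (u p - u c)) {c..p}"
          using primitive_onD(2)[OF u, of c p] p(1) abcd by auto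
        have "norm (integral {c..p} g) \<le> integral {c..p} (\<lambda>x. k x * s + m x)"
        proof (rule Henstock_Kurzweil_Integration.integral_norm_bound_integral)
          show "(\<lambda>x. k x * s + m x) integrable_on {c..p}"
            using p(1) abcd by (intro integrable_add integrable_on_mult_left sub[OF ki] sub[OF mi]) auto
          fix y assume y: "y \<in> {c..p}"
          have "norm (g y) \<le> k y * norm (u y) + m y" using y p(1) abcd by (intro gb) auto
          also have "\<dots> \<le> k y * s + m y" unfolding s_def
            using y p abcd by (intro add_mono mult_left_mono p(2) k0) auto
          finally show "norm (g y) \<le> k y * s + m y" .
        qed (use pi in blast)
        also have "\<dots> = K c p * s + M c p"
          unfolding K_def M_def using p(1) abcd
          by (subst Henstock_Kurzweil_Integration.integral_add) (auto intro!: integrable_on_mult_left sub[OF ki] sub[OF mi])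
        also have "\<dots> \<le> K c d * s + M c d"
          proof (intro add_mono mult_right_mono)
          have ord: "a \<le> c" "c \<le> p" "p \<le> d" "d \<le> b" using p(1) abcd by auto
          show "K c p \<le> K c d" "M c p \<le> M c d"
            using KM[OF ord] K0[of p d] M0[of p d] ord by linarith+
        qed (simp add: s_def)
        finally have "norm (u p - u c) \<le> K c d * s + M c d"
          using pi by (simp add: integral_unique)
        then have "s \<le> norm (u c) + M c d + K c d * s"
          using norm_triangle_ineq2[of "u p" "u c"] by (simp add: s_def)
        then have A: "s * (1 - K c d) \<le> norm (u c) + M c d" by (simp add: algebra_simps)
        have "1 \<le> (1 - K c d) * exp (2 * K c d)"
        proof -
          have "1 \<le> (1 - K c d) * (1 + 2 * K c d)"
          proof -
            have "0 \<le> K c d * (1 - 2 * K c d)" using Ks Kn by simp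
            then show ?thesis by (simp add: algebra_simps)
          qed
          also have "\<dots> \<le> (1 - K c d) * exp (2 * K c d)"
            using Ks exp_ge_add_one_self[of "2 * K c d"] by (intro mult_left_mono) auto
          finally show ?thesis .
        qed
        then have "s * 1 \<le> s * ((1 - K c d) * exp (2 * K c d))"
          by (intro mult_left_mono) (auto simp: s_def)
        also have "\<dots> \<le> (norm (u c) + M c d) * exp (2 * K c d)"
          using mult_right_mono[OF A, of "exp (2 * K c d)"] by (simp add: mult.assoc)
        finally have "s \<le> (norm (u c) + M c d) * exp (2 * K c d)" by simp
        moreover have "norm (u d) \<le> s" using p(2)[of d] abcd by (auto simp: s_def)
        ultimately show "norm (u d) \<le> (norm (u c) + M c d) * exp (2 * K c d)" by linarith
      qed
    qed
  qed
  then show ?thesis using ab by (simp add: P_def K_def M_def)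
qed

section \<open>The Dirac system as a differential equation\<close>
lemma norm_vec2: "norm (v :: complex ^ 2) = sqrt ((cmod (v $ 1))\<^sup>2 + (cmod (v $ 2))\<^sup>2)"
  by (simp add: norm_vec_def L2_set_def sum_2)

lemma norm_vec2_le: "norm (v :: complex ^ 2) \<le> cmod (v $ 1) + cmod (v $ 2)"
  unfolding norm_vec2 by (rule sqrt_sum_squares_le_sum) auto

lemma norm_cscale: "norm (c *s (v :: complex ^ 2)) = cmod c * norm v"
  unfolding norm_vec2
  by (simp add: norm_mult power_mult_distrib real_sqrt_mult flip: distrib_left)

lemma bounded_linear_cscale: "bounded_linear (\<lambda>v :: complex ^ 2. c *s v)"
  by (rule bounded_linear_intro[where K = "cmod c"])
    (auto simp: vec_eq_iff algebra_simps norm_cscale)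

text \<open>
  The equation \<open>J y' + P y = h\<close> solved for \<open>y'\<close>, with the inverse of \<open>J\<close> multiplied out.  Every
  statement about the operators becomes one about primitives of this function.
\<close>
definition dirac_rhs ::
    "(real \<Rightarrow> complex) \<Rightarrow> (real \<Rightarrow> complex) \<Rightarrow> vfun \<Rightarrow> vfun \<Rightarrow> vfun" where
  "dirac_rhs p2 p3 y h =
     (\<lambda>x. vector [\<i> * (h x $ 1 - p2 x * y x $ 2), - \<i> * (h x $ 2 - p3 x * y x $ 1)])"

lemma dirac_rhs_nth [simp]:
  "dirac_rhs p2 p3 y h x $ 1 = \<i> * (h x $ 1 - p2 x * y x $ 2)"
  "dirac_rhs p2 p3 y h x $ 2 = - \<i> * (h x $ 2 - p3 x * y x $ 1)"
  by (simp_all add: dirac_rhs_def)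

lemma dirac_expression_eq_iff:
  "h x = Jmat *v w + Pmat p2 p3 x *v y x \<longleftrightarrow> w = dirac_rhs p2 p3 y h x"
proof -
  have solve: "a = - \<i> * b + c \<longleftrightarrow> b = \<i> * (a - c)" "a = \<i> * b + c \<longleftrightarrow> b = - \<i> * (a - c)"
    for a b c :: complex
    by (auto simp: complex_eq_iff)
  have "(h x = Jmat *v w + Pmat p2 p3 x *v y x) \<longleftrightarrow>
      h x $ 1 = - \<i> * w $ 1 + p2 x * y x $ 2 \<and> h x $ 2 = \<i> * w $ 2 + p3 x * y x $ 1"
    by (simp add: vec_eq_iff forall_2 Jmat_def Pmat_def matrix_vector_mult_def sum_2)
  also have "\<dots> \<longleftrightarrow> w $ 1 = \<i> * (h x $ 1 - p2 x * y x $ 2) \<and> w $ 2 = - \<i> * (h x $ 2 - p3 x * y x $ 1)"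
    by (simp only: solve)
  also have "\<dots> \<longleftrightarrow> w = dirac_rhs p2 p3 y h x"
    by (simp add: vec_eq_iff forall_2)
  finally show ?thesis .
qed

lemma dirac_expr_iff:
  assumes I: "I \<in> sets lebesgue"
  shows "dirac_expr I (Pmat p2 p3) y h \<longleftrightarrow> primitive_on I y (dirac_rhs p2 p3 y h)"
proof
  assume "dirac_expr I (Pmat p2 p3) y h"
  then obtain g where g: "primitive_on I y g"
    and ae: "AE x in lebesgue_on I. h x = Jmat *v g x + Pmat p2 p3 x *v y x"
    by (auto simp: dirac_expr_def ac_deriv_on_iff_primitive_on)
  have "AE x in lebesgue. x \<in> I \<longrightarrow> g x = dirac_rhs p2 p3 y h x"
    using ae I by (simp add: AE_restrict_space_iff dirac_expression_eq_iff)
  then obtain N where "N \<in> null_sets lebesgue" "{x. \<not> (x \<in> I \<longrightarrow> g x = dirac_rhs p2 p3 y h x)} \<subseteq> N"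
    by (auto simp: eventually_ae_filter)
  then show "primitive_on I y (dirac_rhs p2 p3 y h)"
    by (intro primitive_on_spike[OF g, of N]) (auto simp: negligible_iff_null_sets)
next
  assume "primitive_on I y (dirac_rhs p2 p3 y h)"
  then show "dirac_expr I (Pmat p2 p3) y h"
    unfolding dirac_expr_def ac_deriv_on_iff_primitive_on
    by (intro exI[of _ "dirac_rhs p2 p3 y h"] conjI AE_I2) (auto simp: dirac_expression_eq_iff)
qed

lemma norm_dirac_rhs_le:
  "norm (dirac_rhs p2 p3 y h x) \<le> (cmod (p2 x) + cmod (p3 x)) * norm (y x) + 2 * norm (h x)"
proof -
  have c: "cmod (v $ i) \<le> norm v" for v :: "complex ^ 2" and i by (rule Finite_Cartesian_Product.norm_nth_le)
  have "norm (dirac_rhs p2 p3 y h x) \<le>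
      cmod (h x $ 1 - p2 x * y x $ 2) + cmod (h x $ 2 - p3 x * y x $ 1)"
    using norm_vec2_le[of "dirac_rhs p2 p3 y h x"] by (simp add: norm_mult)
  also have "\<dots> \<le> (norm (h x) + cmod (p2 x) * norm (y x)) + (norm (h x) + cmod (p3 x) * norm (y x))"
    by (intro add_mono order_trans[OF norm_triangle_ineq4])
      (auto simp: norm_mult intro!: c mult_left_mono)
  finally show ?thesis by (simp add: algebra_simps)
qed

lemma dirac_solution_add:
  assumes "primitive_on I y1 (dirac_rhs p2 p3 y1 h1)" "primitive_on I y2 (dirac_rhs p2 p3 y2 h2)"
  shows "primitive_on I (\<lambda>x. y1 x + y2 x)
     (dirac_rhs p2 p3 (\<lambda>x. y1 x + y2 x) (\<lambda>x. h1 x + h2 x))"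
  by (rule primitive_on_cong[OF primitive_on_add[OF assms]])
    (auto simp: vec_eq_iff forall_2 algebra_simps)

lemma dirac_solution_cscale:
  assumes "primitive_on I y (dirac_rhs p2 p3 y h)"
  shows "primitive_on I (\<lambda>x. c *s y x) (dirac_rhs p2 p3 (\<lambda>x. c *s y x) (\<lambda>x. c *s h x))"
  by (rule primitive_on_cong[OF primitive_on_bounded_linear[OF bounded_linear_cscale assms]])
    (auto simp: vec_eq_iff forall_2 algebra_simps)

lemma dirac_solution_diff:
  assumes "primitive_on I y1 (dirac_rhs p2 p3 y1 h1)" "primitive_on I y2 (dirac_rhs p2 p3 y2 h2)"
  shows "primitive_on I (\<lambda>x. y1 x - y2 x)
     (dirac_rhs p2 p3 (\<lambda>x. y1 x - y2 x) (\<lambda>x. h1 x - h2 x))"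
  by (rule primitive_on_cong[OF dirac_solution_add[OF assms(1) dirac_solution_cscale[OF assms(2), of "-1"]]])
    (auto simp: vec_eq_iff forall_2 algebra_simps)

locale dirac_potential =
  fixes p2 p3 :: "real \<Rightarrow> complex"
  assumes p2_locally_integrable: "locally_integrable p2"
    and p3_locally_integrable: "locally_integrable p3"
begin

definition pot :: "real \<Rightarrow> real" where "pot x = cmod (p2 x) + cmod (p3 x)"

abbreviation rhs :: "vfun \<Rightarrow> vfun \<Rightarrow> vfun" where "rhs \<equiv> dirac_rhs p2 p3"

lemma pot_nonneg: "0 \<le> pot x" by (simp add: pot_def)

lemma pot_integrable: "pot integrable_on {a..b}"
  using p2_locally_integrable p3_locally_integrable
  unfolding pot_def locally_integrable_def absolutely_integrable_on_def
  by (auto intro!: integrable_add)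

text \<open>
  The forcing term \<open>h\<close> is allowed to grow with \<open>y\<close> because the spectral parameter is treated as part of
  it: uniqueness is the case \<open>h = z y\<close>, continuity in \<open>z\<close> is the case of a difference of two
  solutions, and the local control of functions in the domain of \<open>L\<close> is the case \<open>\<kappa> = 0\<close>.
\<close>
lemma dirac_gronwall:
  assumes "a \<le> b" "primitive_on {a..b} y (rhs y h)" "\<kappa> \<ge> 0"
    and "m integrable_on {a..b}" "\<And>x. x \<in> {a..b} \<Longrightarrow> 0 \<le> m x"
    and h: "\<And>x. x \<in> {a..b} \<Longrightarrow> norm (h x) \<le> \<kappa> * norm (y x) + m x"
  shows "norm (y b) \<le> (norm (y a) + 2 * integral {a..b} m) * exp (2 * (integral {a..b} pot + 2 * \<kappa> * (b - a)))"
proof -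
  have "norm (y b) \<le> (norm (y a) + integral {a..b} (\<lambda>x. 2 * m x)) *
      exp (2 * integral {a..b} (\<lambda>x. pot x + 2 * \<kappa>))"
  proof (rule gronwall[OF assms(1,2)])
    fix x assume x: "x \<in> {a..b}"
    have "norm (rhs y h x) \<le> pot x * norm (y x) + 2 * norm (h x)"
      unfolding pot_def by (rule norm_dirac_rhs_le)
    also have "\<dots> \<le> (pot x + 2 * \<kappa>) * norm (y x) + 2 * m x"
      using h[OF x] by (simp add: algebra_simps)
    finally show "norm (rhs y h x) \<le> (pot x + 2 * \<kappa>) * norm (y x) + 2 * m x" .
  qed (use assms pot_nonneg in \<open>auto intro!: integrable_add pot_integrable integrable_on_mult_right\<close>)
  also have "integral {a..b} (\<lambda>x. pot x + 2 * \<kappa>) = integral {a..b} pot + 2 * \<kappa> * (b - a)"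
    using assms(1) by (subst Henstock_Kurzweil_Integration.integral_add) (auto intro!: pot_integrable)
  finally show ?thesis by simp
qed

lemma dirac_solution_unique:
  assumes "primitive_on {a..b} y (rhs y (\<lambda>x. z *s y x))"
    and "primitive_on {a..b} w (rhs w (\<lambda>x. z *s w x))"
    and "y a = w a" "x \<in> {a..b}"
  shows "y x = w x"
proof -
  have x: "{a..x} \<subseteq> {a..b}" "a \<le> x" using assms(4) by auto
  have "primitive_on {a..b} (\<lambda>x. y x - w x) (rhs (\<lambda>x. y x - w x) (\<lambda>x. z *s y x - z *s w x))"
    by (rule dirac_solution_diff[OF assms(1,2)])
  then have "primitive_on {a..x} (\<lambda>x. y x - w x) (rhs (\<lambda>x. y x - w x) (\<lambda>x. z *s (y x - w x)))"
    using primitive_on_subset[OF _ x(1)] by (simp add: vector_ssub_ldistrib)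
  from dirac_gronwall[OF x(2) this, of "cmod z" "\<lambda>_. 0"]
  have "norm (y x - w x) \<le> 0"
    using assms(3) integrable_0[of "{a..x}"] by (simp add: norm_cscale flip: vector_ssub_ldistrib)
  then show ?thesis by simp
qed

end

locale dirac_fundamental = dirac_potential +
  fixes E :: "real \<Rightarrow> complex \<Rightarrow> complex ^ 2 ^ 2"
  assumes fundamental: "fundamental_matrix (Pmat p2 p3) E"
begin

lemma E_0: "E 0 z = mat 1"
  using fundamental by (auto simp: fundamental_matrix_def)

lemma primitive_on_column:
  "primitive_on UNIV (\<lambda>x. column j (E x z)) (rhs (\<lambda>x. column j (E x z)) (\<lambda>x. z *s column j (E x z)))"
  using fundamental by (simp add: fundamental_matrix_def dirac_expr_iff)

lemma E_mult_eq: "E x z *v v = v $ 1 *s column 1 (E x z) + v $ 2 *s column 2 (E x z)"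
  by (simp add: vec_eq_iff matrix_vector_mult_def sum_2 column_def algebra_simps)

lemma primitive_on_E_mult:
  "primitive_on UNIV (\<lambda>x. E x z *v v) (rhs (\<lambda>x. E x z *v v) (\<lambda>x. z *s (E x z *v v)))"
  unfolding E_mult_eq
  by (rule primitive_on_cong[OF dirac_solution_add[OF
        dirac_solution_cscale[OF primitive_on_column[of 1], of "v $ 1"]
        dirac_solution_cscale[OF primitive_on_column[of 2], of "v $ 2"]]])
    (auto simp: vec_eq_iff forall_2 algebra_simps)

lemma solution_eq_E_mult:
  assumes "primitive_on {0..b} y (rhs y (\<lambda>x. z *s y x))" "x \<in> {0..b}"
  shows "y x = E x z *v y 0"
  by (rule dirac_solution_unique[OF assms(1) primitive_on_subset[OF primitive_on_E_mult] _ assms(2)])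
    (auto simp: E_0)

text \<open>
  Liouville's formula: the matrix of the first-order system has the diagonal \<open>(\<i> z, - \<i> z)\<close>, hence
  trace zero.  For coefficients that are only integrable it is an instance of the product rule.
\<close>
lemma det_E: "det (E x z) = 1"
proof -
  define e where "e i j x = E x z $ i $ j" for i j x
  have e: "primitive_on UNIV (e 1 j) (\<lambda>x. \<i> * (z * e 1 j x - p2 x * e 2 j x))"
    "primitive_on UNIV (e 2 j) (\<lambda>x. - \<i> * (z * e 2 j x - p3 x * e 1 j x))" for j
    using primitive_on_bounded_linear[OF bounded_linear_vec_nth[of 1] primitive_on_column[of j z]]
      primitive_on_bounded_linear[OF bounded_linear_vec_nth[of 2] primitive_on_column[of j z]]
    by (simp_all add: column_def e_def[abs_def])
  have "primitive_on UNIV (\<lambda>x. e 1 1 x * e 2 2 x + (- (e 1 2 x * e 2 1 x))) (\<lambda>x. 0)"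
    by (rule primitive_on_cong[OF primitive_on_add[OF
          primitive_on_product[OF bounded_bilinear_mult e(1)[of 1] e(2)[of 2]]
          primitive_on_bounded_linear[OF bounded_linear_minus[OF bounded_linear_ident]
            primitive_on_product[OF bounded_bilinear_mult e(1)[of 2] e(2)[of 1]]]]])
      (auto simp: algebra_simps)
  then have p: "primitive_on UNIV (\<lambda>x. det (E x z)) (\<lambda>x. 0)"
    by (simp add: det_2 e_def)
  have "det (E b z) = det (E a z)" if "a \<le> b" for a b
    using primitive_onD(2)[OF p that] has_integral_unique[OF _ has_integral_0] by fastforce
  then have "det (E x z) = det (E 0 z)" by (metis linear)
  then show ?thesis by (simp add: E_0)
qed

text \<open>
  The difference of the solutions for \<open>z\<close> and \<open>z0\<close> with equal initial values solves the equation for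
  \<open>z\<close> with the additional forcing \<open>(z - z0) y0\<close>, so the Gronwall inequality bounds it by a multiple of
  \<open>cmod (z - z0)\<close>.
\<close>
lemma continuous_E_pi: "isCont (\<lambda>z. E pi z *v v) z0"
proof -
  have cont: "continuous_on {0..pi} (\<lambda>x. E x z0 *v v)"
    by (rule primitive_on_continuous, rule primitive_on_subset[OF primitive_on_E_mult]) simp
  then have "bounded ((\<lambda>x. E x z0 *v v) ` {0..pi})"
    by (intro compact_imp_bounded compact_continuous_image) auto
  then obtain B where B: "\<And>x. x \<in> {0..pi} \<Longrightarrow> norm (E x z0 *v v) \<le> B"
    unfolding bounded_iff by (metis imageI)
  have B0: "B \<ge> 0" using order_trans[OF norm_ge_zero B[of 0]] by simp
  define C where "C = 2 * (pi * B) * exp (2 * (integral {0..pi} pot + 2 * (cmod z0 + 1) * pi))"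
  have est: "norm (E pi z *v v - E pi z0 *v v) \<le> C * cmod (z - z0)" if z: "cmod (z - z0) < 1" for z
  proof -
    let ?d = "\<lambda>x. E x z *v v - E x z0 *v v"
    have zz: "cmod z \<le> cmod z0 + 1" using z norm_triangle_ineq2[of z z0] by linarith
    have "primitive_on {0..pi} ?d (rhs ?d (\<lambda>x. z *s (E x z *v v) - z0 *s (E x z0 *v v)))"
      by (rule primitive_on_subset[OF dirac_solution_diff[OF primitive_on_E_mult primitive_on_E_mult]]) simp
    from dirac_gronwall[OF _ this, of "cmod z0 + 1" "\<lambda>_. cmod (z - z0) * B"]
    have "norm (?d pi) \<le> (norm (?d 0) + 2 * integral {0..pi} (\<lambda>_. cmod (z - z0) * B)) *
        exp (2 * (integral {0..pi} pot + 2 * (cmod z0 + 1) * (pi - 0)))"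
    proof (rule meta_mp)
      fix x :: real assume x: "x \<in> {0..pi}"
      have "z *s (E x z *v v) - z0 *s (E x z0 *v v) = z *s ?d x + (z - z0) *s (E x z0 *v v)"
        by (simp add: vec_eq_iff algebra_simps)
      also have "norm \<dots> \<le> cmod z * norm (?d x) + cmod (z - z0) * norm (E x z0 *v v)"
        by (metis norm_triangle_ineq norm_cscale)
      also have "\<dots> \<le> (cmod z0 + 1) * norm (?d x) + cmod (z - z0) * B"
        by (intro add_mono mult_mono B x zz) auto
      finally show "norm (z *s (E x z *v v) - z0 *s (E x z0 *v v))
        \<le> (cmod z0 + 1) * norm (?d x) + cmod (z - z0) * B" .
    qed (use B0 in auto)
    then show ?thesis by (simp add: E_0 C_def algebra_simps)
  qed
  have "((\<lambda>z. E pi z *v v - E pi z0 *v v) \<longlongrightarrow> 0) (at z0)"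
  proof (rule Lim_null_comparison)
    show "eventually (\<lambda>z. norm (E pi z *v v - E pi z0 *v v) \<le> C * cmod (z - z0)) (at z0)"
      unfolding eventually_at by (intro exI[of _ 1]) (use est in \<open>auto simp: dist_norm\<close>)
    show "((\<lambda>z. C * cmod (z - z0)) \<longlongrightarrow> 0) (at z0)"
      by (rule tendsto_eq_intros | simp)+
  qed
  then show ?thesis unfolding isCont_def using LIM_zero_iff by blast
qed

text \<open>The Hill discriminant, that is, the trace of the monodromy matrix.\<close>
definition discr :: "complex \<Rightarrow> complex" where
  "discr z = E pi z $ 1 $ 1 + E pi z $ 2 $ 2"

lemma isCont_discr: "isCont discr z"
proof -
  have "discr w = (E pi w *v axis 1 1) $ 1 + (E pi w *v axis 2 1) $ 2" for w
    by (simp add: discr_def matrix_vector_mult_def sum_2 axis_def)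
  then have "discr = (\<lambda>w. (E pi w *v axis 1 1) $ 1 + (E pi w *v axis 2 1) $ 2)" by auto
  then show ?thesis
    by (simp only:) (intro continuous_intros continuous_E_pi)
qed

text \<open>
  With determinant one, the characteristic polynomial of the monodromy matrix at \<open>u\<close> is
  \<open>u (u + 1 / u - discr z)\<close>, and \<open>u + 1 / u = 2 cos (pi t)\<close> for \<open>u = exp (\<i> pi t)\<close>.
\<close>
lemma det_multiplier_eq_0_iff:
  "det (E pi z - mat (exp (\<i> * of_real (pi * t)))) = 0 \<longleftrightarrow> discr z = of_real (2 * cos (pi * t))"
proof -
  define u where "u = exp (\<i> * complex_of_real (pi * t))"
  define v where "v = exp (- \<i> * complex_of_real (pi * t))"
  have uv: "u * v = 1" by (simp add: u_def v_def flip: exp_add)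
  have c: "complex_of_real (2 * cos (pi * t)) = u + v"
    by (simp add: cos_of_real[symmetric] cos_exp_eq u_def v_def)
  have "det (E pi z - mat u) = det (E pi z) - u * discr z + u * u"
    by (simp add: det_2 mat_def discr_def algebra_simps)
  also have "\<dots> = u * (u + v - discr z)"
    using uv by (simp add: det_E algebra_simps)
  finally have "det (E pi z - mat u) = u * (u + v - discr z)" .
  moreover have "u \<noteq> 0" by (simp add: u_def)
  ultimately show ?thesis unfolding c u_def[symmetric] by auto
qed

end

section \<open>Eigenvalues and the discriminant\<close>
lemma det_eq_0_iff_kernel:
  fixes A :: "'a::field ^ 'n ^ 'n"
  shows "det A = 0 \<longleftrightarrow> (\<exists>v. v \<noteq> 0 \<and> A *v v = 0)"
  using invertible_det_nz[of A] invertible_left_inverse[of A] matrix_left_invertible_ker[of A] by blast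

definition vcnj :: "complex ^ 2 \<Rightarrow> complex ^ 2" where "vcnj v = (\<chi> i. cnj (v $ i))"

lemma vcnj_nth [simp]: "vcnj v $ i = cnj (v $ i)" by (simp add: vcnj_def)

lemma bounded_linear_vcnj: "bounded_linear vcnj"
  by (rule bounded_linear_intro[where K = 1])
    (auto simp: vec_eq_iff norm_vec2)

lemma dirac_op_iff:
  assumes "I \<in> sets lebesgue"
  shows "(y, h) \<in> dirac_op I (Pmat p2 p3) \<longleftrightarrow>
    square_integrable I y \<and> square_integrable I h \<and> (\<forall>x. x \<notin> I \<longrightarrow> y x = 0) \<and>
    primitive_on I y (dirac_rhs p2 p3 y h)"
  by (simp add: dirac_op_def dirac_expr_iff[OF assms])

lemma square_integrable_continuous_on:
  assumes "continuous_on {a..b} y"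
  shows "square_integrable {a..b} y"
  unfolding square_integrable_def
  using assms by (intro conjI continuous_imp_measurable_on_sets_lebesgue continuous_imp_integrable_real
      continuous_intros) auto

context dirac_fundamental
begin

lemma eigenvalue_iff_discr:
  "eigenvalue (dirac_Lt t (Pmat p2 p3)) z \<longleftrightarrow> discr z = of_real (2 * cos (pi * t))"
proof -
  let ?u = "exp (\<i> * complex_of_real (pi * t))"
  have mv: "(E pi z - mat ?u) *v v = E pi z *v v - ?u *s v" for v
    by (simp add: vec_eq_iff forall_2 matrix_vector_mult_def sum_2 mat_def algebra_simps)
  have "eigenvalue (dirac_Lt t (Pmat p2 p3)) z \<longleftrightarrow> (\<exists>v. v \<noteq> 0 \<and> E pi z *v v = ?u *s v)"
  proof
    assume "eigenvalue (dirac_Lt t (Pmat p2 p3)) z"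
    then obtain y where y: "y \<noteq> 0" "(y, cscale z y) \<in> dirac_op {0..pi} (Pmat p2 p3)" "y pi = ?u *s y 0"
      by (auto simp: eigenvalue_def dirac_Lt_def)
    then have "primitive_on {0..pi} y (rhs y (\<lambda>x. z *s y x))" and z: "\<And>x. x \<notin> {0..pi} \<Longrightarrow> y x = 0"
      by (auto simp: dirac_op_iff cscale_def)
    then have eq: "y x = E x z *v y 0" if "x \<in> {0..pi}" for x
      using solution_eq_E_mult that by blast
    have "y 0 \<noteq> 0"
    proof
      assume "y 0 = 0"
      then have "y x = 0" for x using eq[of x] z[of x] by (cases "x \<in> {0..pi}") auto
      with y(1) show False by (auto simp: fun_eq_iff)
    qed
    with y(3) eq[of pi] show "\<exists>v. v \<noteq> 0 \<and> E pi z *v v = ?u *s v" by auto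
  next
    assume "\<exists>v. v \<noteq> 0 \<and> E pi z *v v = ?u *s v"
    then obtain v where v: "v \<noteq> 0" "E pi z *v v = ?u *s v" by blast
    define y where "y x = (if x \<in> {0..pi} then E x z *v v else 0)" for x
    have p: "primitive_on {0..pi} y (rhs y (\<lambda>x. z *s y x))"
      by (rule primitive_on_cong[OF primitive_on_subset[OF primitive_on_E_mult[of z v]]])
        (auto simp: y_def vec_eq_iff forall_2)
    then have c: "continuous_on {0..pi} y" by (rule primitive_on_continuous)
    have "continuous_on {0..pi} (\<lambda>x. z *s y x)"
      by (rule bounded_linear.continuous_on[OF bounded_linear_cscale c])
    with p c have "(y, cscale z y) \<in> dirac_op {0..pi} (Pmat p2 p3)"
      by (auto simp: dirac_op_iff cscale_def y_def intro!: square_integrable_continuous_on)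
    moreover have "y 0 = v" "y pi = ?u *s v" using v by (simp_all add: y_def E_0)
    ultimately show "eigenvalue (dirac_Lt t (Pmat p2 p3)) z"
      unfolding eigenvalue_def dirac_Lt_def using v(1) by (intro exI[of _ y]) auto
  qed
  also have "\<dots> \<longleftrightarrow> det (E pi z - mat ?u) = 0"
    unfolding det_eq_0_iff_kernel mv by auto
  also have "\<dots> \<longleftrightarrow> discr z = of_real (2 * cos (pi * t))"
    by (rule det_multiplier_eq_0_iff)
  finally show ?thesis .
qed

end

locale dirac_periodic = dirac_fundamental +
  assumes p2_periodic: "p2 (x + pi) = p2 x" and p3_periodic: "p3 (x + pi) = p3 x"
begin

lemma solution_shift:
  assumes "primitive_on UNIV y (rhs y (\<lambda>x. z *s y x))" "\<And>x. p2 (x + c) = p2 x" "\<And>x. p3 (x + c) = p3 x"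
  shows "primitive_on UNIV (\<lambda>x. y (x + c)) (rhs (\<lambda>x. y (x + c)) (\<lambda>x. z *s y (x + c)))"
  by (rule primitive_on_cong[OF primitive_on_shift[OF assms(1), of c]])
    (auto simp: vec_eq_iff forall_2 assms)

lemma E_add_pi:
  assumes "x \<ge> 0"
  shows "E (x + pi) z *v v = E x z *v (E pi z *v v)"
  using solution_eq_E_mult[OF primitive_on_subset[OF solution_shift[OF primitive_on_E_mult]], of pi x x z v]
    assms p2_periodic p3_periodic by auto

text \<open>
  The shifted solution \<open>x \<mapsto> E (x - pi) z v\<close> starts at \<open>E (- pi) z v\<close> and arrives at \<open>v\<close> when
  \<open>x = pi\<close>; thus \<open>E (- pi) z\<close> is the inverse of the monodromy matrix.
\<close>
lemma E_pi_E_minus_pi: "E pi z *v (E (- pi) z *v v) = v"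
proof -
  have "p2 (x + - pi) = p2 x" "p3 (x + - pi) = p3 x" for x
    using p2_periodic[of "x - pi"] p3_periodic[of "x - pi"] by auto
  from solution_eq_E_mult[OF primitive_on_subset[OF solution_shift[OF primitive_on_E_mult this]], of pi pi z v]
  show ?thesis by (auto simp: E_0)
qed

end

locale dirac_pt_symmetric = dirac_periodic +
  assumes p2_pt: "cnj (p2 (- x)) = p2 x" and p3_pt: "cnj (p3 (- x)) = p3 x"
begin

lemma E_cnj:
  assumes "x \<ge> 0"
  shows "E x (cnj z) *v vcnj v = vcnj (E (- x) z *v v)"
proof -
  let ?w = "\<lambda>x. vcnj (E (- x) z *v v)"
  have "primitive_on UNIV ?w (rhs ?w (\<lambda>x. cnj z *s ?w x))"
    by (rule primitive_on_cong[OF primitive_on_bounded_linear[OF bounded_linear_vcnj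
            primitive_on_reflect[OF primitive_on_E_mult[of z v]]]])
      (auto simp: vec_eq_iff forall_2 p2_pt p3_pt algebra_simps)
  from solution_eq_E_mult[OF primitive_on_subset[OF this], of x x] assms
  show ?thesis by (simp add: E_0)
qed

text \<open>
  By the symmetry of the potential the monodromy matrix for \<open>cnj z\<close> is the conjugate of
  \<open>E (- pi) z\<close>, the inverse of \<open>E pi z\<close>.  Inverting a two by two matrix of determinant one
  exchanges its diagonal entries and so preserves the trace.
\<close>
lemma discr_cnj: "discr (cnj z) = cnj (discr z)"
proof -
  define a where "a i j = E pi z $ i $ j" for i j
  define b where "b i j = E (- pi) z $ i $ j" for i j
  have mv: "M *v axis j 1 = column j M" for M :: "complex ^ 2 ^ 2" and j
    using exhaust_2[of j]
    by (auto simp: vec_eq_iff matrix_vector_mult_def sum_2 axis_def column_def forall_2)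
  have ax: "vcnj (axis j 1) = axis j 1" for j by (simp add: vec_eq_iff axis_def)
  have e: "E pi (cnj z) $ i $ j = cnj (b i j)" for i j
    using arg_cong[where f = "\<lambda>v. v $ i", OF E_cnj[of pi z "axis j 1"]]
    by (simp add: ax mv column_def b_def)
  have ab: "(a i 1 * b 1 j + a i 2 * b 2 j) = (if i = j then 1 else 0)" for i j
    using arg_cong[where f = "\<lambda>v. v $ i", OF E_pi_E_minus_pi[of z "axis j 1"]]
    using exhaust_2[of j]
    by (auto simp: mv column_def matrix_vector_mult_def sum_2 a_def b_def axis_def)
  have d: "a 1 1 * a 2 2 - a 1 2 * a 2 1 = 1"
    using det_E[of pi z] by (simp add: det_2 a_def)
  have "b 1 1 = (a 1 1 * a 2 2 - a 1 2 * a 2 1) * b 1 1" by (simp add: d)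
  also have "\<dots> = a 2 2 * (a 1 1 * b 1 1 + a 1 2 * b 2 1) - a 1 2 * (a 2 1 * b 1 1 + a 2 2 * b 2 1)"
    by (simp add: algebra_simps)
  finally have b1: "b 1 1 = a 2 2" by (simp add: ab)
  have "b 2 2 = (a 1 1 * a 2 2 - a 1 2 * a 2 1) * b 2 2" by (simp add: d)
  also have "\<dots> = a 1 1 * (a 2 1 * b 1 2 + a 2 2 * b 2 2) - a 2 1 * (a 1 1 * b 1 2 + a 1 2 * b 2 2)"
    by (simp add: algebra_simps)
  finally have b2: "b 2 2 = a 1 1" by (simp add: ab)
  show ?thesis
    by (simp add: discr_def e b1 b2 a_def[symmetric])
qed

lemma discr_real: "discr (of_real x) = of_real (Re (discr (of_real x)))"
  using discr_cnj[of "of_real x"] by (simp add: complex_eq_iff)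

end

section \<open>Continuous functions attaining moving levels once\<close>

text \<open>
  Suppose \<open>F x0 > c a\<close>.  For \<open>t\<close> within \<open>e\<close> of \<open>x0\<close> the point where \<open>F\<close> attains \<open>c t\<close> is never
  \<open>x0\<close>, so it lies to the right (\<open>t \<in> A\<close>) or to the left (\<open>t \<in> B\<close>) of \<open>x0\<close>.  At this point \<open>F\<close>
  falls below the level: a mere contact from above would split into two points for the slightly higher
  level of a smaller \<open>t\<close>.  Values below the level persist under small changes of \<open>t\<close>, so \<open>A\<close> and
  \<open>B\<close> are open and one of them is the whole interval.  Say it is \<open>A\<close>, and let \<open>t\<close> decrease to
  \<open>x0 - e\<close>: the point is caught between \<open>x0\<close> and \<open>t + e\<close> and tends to \<open>x0\<close>, whence
  \<open>F x0 = c (x0 - e) \<le> c a\<close>, a contradiction.  For \<open>B\<close> let \<open>t\<close> increase to \<open>x0 + e\<close>.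
\<close>
lemma unique_level_point_bound:
  fixes F c :: "real \<Rightarrow> real"
  assumes F: "continuous_on UNIV F" and c: "continuous_on UNIV c"
    and mono: "\<And>s t. a \<le> s \<Longrightarrow> s < t \<Longrightarrow> t \<le> b \<Longrightarrow> c t < c s"
    and e: "e > 0"
    and uniq: "\<And>t. t \<in> {a..b} \<Longrightarrow> \<exists>!x. x \<in> {t - e<..<t + e} \<and> F x = c t"
    and x0: "a + e \<le> x0" "x0 \<le> b - e"
  shows "F x0 \<le> c a"
proof (rule ccontr)
  assume "\<not> F x0 \<le> c a"
  then have big: "F x0 > c t" if "t \<in> {a..b}" for t
    using mono[of a t] that by (cases "t = a") (auto simp: not_le)
  have cF: "continuous_on S F" for S using F continuous_on_subset by blast
  have cc: "isCont c t" for t using c by (simp add: continuous_on_eq_continuous_at)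
  define J where "J = {x0 - e<..<x0 + e}"
  have Jab: "t \<in> {a..b}" if "t \<in> J" for t using that x0 by (auto simp: J_def)
  define A where "A = {t. \<exists>x. x \<in> {t - e<..<t + e} \<and> F x = c t \<and> x0 < x}"
  define B where "B = {t. \<exists>x. x \<in> {t - e<..<t + e} \<and> F x = c t \<and> x < x0}"
  have cover: "t \<in> A \<union> B" if t: "t \<in> J" for t
  proof -
    obtain x where x: "x \<in> {t - e<..<t + e}" "F x = c t" using uniq[OF Jab[OF t]] by metis
    moreover have "x \<noteq> x0" using big[OF Jab[OF t]] x by auto
    ultimately show ?thesis unfolding A_def B_def using linorder_neqE_linordered_idom by blast
  qed
  have disj: "t \<notin> A \<inter> B" if t: "t \<in> J" for t
  proof
    assume "t \<in> A \<inter> B"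
    then obtain x y where "x \<in> {t - e<..<t + e}" "F x = c t" "x0 < x"
      "y \<in> {t - e<..<t + e}" "F y = c t" "y < x0"
      unfolding A_def B_def by blast
    moreover from this have "x = y" using uniq[OF Jab[OF t]] by blast
    ultimately show False by simp
  qed
  \<comment> \<open>Beyond the point \<open>x\<close>, seen from \<open>x0\<close>, there is a point \<open>u\<close> where \<open>F\<close> is below the level.\<close>
  have below: "\<exists>u\<in>{t - e<..<t + e}. \<bar>u - x0\<bar> > \<bar>x - x0\<bar> \<and> (u - x0) * (x - x0) > 0 \<and> F u < c t"
    if t: "t \<in> J" and x: "x \<in> {t - e<..<t + e}" "F x = c t" for t x
  proof (rule ccontr)
    assume neg: "\<not> ?thesis"
    have xx: "x \<noteq> x0" using big[OF Jab[OF t]] x by auto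
    \<comment> \<open>any point strictly between \<open>x\<close> and the far end of the window would do\<close>
    define u where "u = (if x0 < x then (x + (t + e)) / 2 else (x + (t - e)) / 2)"
    have u: "u \<in> {t - e<..<t + e}" "\<bar>u - x0\<bar> > \<bar>x - x0\<bar>" "(u - x0) * (x - x0) > 0" "u \<noteq> x"
      using x xx t by (auto simp: u_def J_def zero_less_mult_iff split: if_splits)
    with neg have "F u \<ge> c t" by (meson not_le)
    moreover have "F u \<noteq> c t" using uniq[OF Jab[OF t]] x u by blast
    ultimately have Fu: "F u > c t" by simp
    have "t > a" using t x0 by (auto simp: J_def)
    \<comment> \<open>If \<open>F\<close> only touches the level, then for a slightly smaller \<open>s\<close> the higher level \<open>c s\<close> is
      attained on both sides of \<open>x\<close>.\<close>
    have ev: "\<forall>\<^sub>F s in at_left t. a < s \<and> x0 \<in> {s - e<..<s + e} \<and> u \<in> {s - e<..<s + e} \<and> x \<in> {s - e<..<s + e}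
       \<and> c s < F u \<and> s < t"
    proof (intro eventually_conj)
      have o: "\<forall>\<^sub>F s in at_left t. s \<in> S" if "open S" "t \<in> S" for S
        using topological_tendstoD[OF tendsto_ident_at that] .
      show "\<forall>\<^sub>F s in at_left t. a < s" using o[of "{a<..}"] \<open>t > a\<close> by simp
      have "\<forall>\<^sub>F s in at_left t. y \<in> {s - e<..<s + e}" if "y \<in> {t - e<..<t + e}" for y
      proof -
        have "\<forall>\<^sub>F s in at_left t. s \<in> {y - e<..<y + e}" using that by (intro o) auto
        then show ?thesis by (rule eventually_mono) auto
      qed
      then show "\<forall>\<^sub>F s in at_left t. x0 \<in> {s - e<..<s + e}" "\<forall>\<^sub>F s in at_left t. u \<in> {s - e<..<s + e}"
        "\<forall>\<^sub>F s in at_left t. x \<in> {s - e<..<s + e}"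
        using t x u by (auto simp: J_def)
      have "(c \<longlongrightarrow> c t) (at_left t)" using cc[of t] filterlim_at_split isCont_def by blast
      then show "\<forall>\<^sub>F s in at_left t. c s < F u" using Fu order_tendstoD(2) by blast
      show "\<forall>\<^sub>F s in at_left t. s < t" by (simp add: eventually_at_filter)
    qed
    obtain s where s: "a < s" "x0 \<in> {s - e<..<s + e}" "u \<in> {s - e<..<s + e}" "x \<in> {s - e<..<s + e}"
      "c s < F u" "s < t"
      using eventually_happens'[OF trivial_limit_at_left_real ev] by blast
    have sab: "s \<in> {a..b}" using s Jab[OF t] by auto
    have cs: "c t < c s" using mono s Jab[OF t] by auto
    have root: "\<exists>y. y \<in> {min p q..max p q} \<and> F y = c s" if "F p \<ge> c s" "F q \<le> c s" for p q
    proof (cases "p \<le> q")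
      case True
      then show ?thesis using IVT2'[of F q "c s" p] that cF by (auto simp: min_def max_def)
    next
      case False
      then show ?thesis using IVT'[of F q "c s" p] that cF by (auto simp: min_def max_def)
    qed
    obtain y1 where y1: "y1 \<in> {min x0 x..max x0 x}" "F y1 = c s"
      using root[of x0 x] big[OF sab] cs x by auto
    obtain y2 where y2: "y2 \<in> {min u x..max u x}" "F y2 = c s"
      using root[of u x] s cs x by auto
    have "y1 \<noteq> x" using y1 x cs by auto
    have "y1 \<noteq> y2"
      using y1 y2 u \<open>y1 \<noteq> x\<close> by (auto simp: zero_less_mult_iff min_def max_def split: if_splits)
    moreover have "y1 \<in> {s - e<..<s + e}" "y2 \<in> {s - e<..<s + e}"
      using y1(1) y2(1) s by (auto simp: min_def max_def split: if_splits)
    ultimately show False using uniq[OF sab] y1 y2 by blast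
  qed
  have near: "\<forall>\<^sub>F s in at t. s \<in> J \<and> u \<in> {s - e<..<s + e} \<and> F u < c s"
    if "t \<in> J" "u \<in> {t - e<..<t + e}" "F u < c t" for t u
  proof (intro eventually_conj)
    have o: "\<forall>\<^sub>F s in at t. s \<in> S" if "open S" "t \<in> S" for S
      using topological_tendstoD[OF tendsto_ident_at that] .
    show "\<forall>\<^sub>F s in at t. s \<in> J" using that by (intro o) (auto simp: J_def)
    have "\<forall>\<^sub>F s in at t. s \<in> {u - e<..<u + e}" using that by (intro o) auto
    then show "\<forall>\<^sub>F s in at t. u \<in> {s - e<..<s + e}"
      by (rule eventually_mono) auto
    have "(c \<longlongrightarrow> c t) (at t)" using cc[of t] by (simp add: isCont_def)
    then show "\<forall>\<^sub>F s in at t. F u < c s" using that order_tendstoD(1) by blast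
  qed
  have openA: "\<forall>\<^sub>F s in at t. s \<in> A" if t: "t \<in> J" "t \<in> A" for t
  proof -
    obtain x where x: "x \<in> {t - e<..<t + e}" "F x = c t" "x0 < x" using t by (auto simp: A_def)
    obtain u where u: "u \<in> {t - e<..<t + e}" "x0 < u" "F u < c t"
      using below[OF t(1) x(1,2)] x(3) by (auto simp: zero_less_mult_iff)
    show ?thesis
    proof (rule eventually_mono[OF near[OF t(1) u(1,3)]])
      fix s assume s: "s \<in> J \<and> u \<in> {s - e<..<s + e} \<and> F u < c s"
      obtain y where y: "x0 \<le> y" "y \<le> u" "F y = c s"
        using IVT2'[of F u "c s" x0] s big[OF Jab[of s]] u cF by fastforce
      moreover have "y \<noteq> x0" using y big[OF Jab[of s]] s by auto
      ultimately show "s \<in> A" unfolding A_def using s by (auto simp: J_def intro!: exI[of _ y])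
    qed
  qed
  have openB: "\<forall>\<^sub>F s in at t. s \<in> B" if t: "t \<in> J" "t \<in> B" for t
  proof -
    obtain x where x: "x \<in> {t - e<..<t + e}" "F x = c t" "x < x0" using t by (auto simp: B_def)
    obtain u where u: "u \<in> {t - e<..<t + e}" "u < x0" "F u < c t"
      using below[OF t(1) x(1,2)] x(3) by (auto simp: zero_less_mult_iff)
    show ?thesis
    proof (rule eventually_mono[OF near[OF t(1) u(1,3)]])
      fix s assume s: "s \<in> J \<and> u \<in> {s - e<..<s + e} \<and> F u < c s"
      obtain y where y: "u \<le> y" "y \<le> x0" "F y = c s"
        using IVT'[of F u "c s" x0] s big[OF Jab[of s]] u cF by fastforce
      moreover have "y \<noteq> x0" using y big[OF Jab[of s]] s by auto
      ultimately show "s \<in> B" unfolding B_def using s by (auto simp: J_def intro!: exI[of _ y])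
    qed
  qed
  have JAB: "open (J \<inter> A)" "open (J \<inter> B)"
  proof -
    have oo: "open (J \<inter> X)" if "\<And>t. t \<in> J \<Longrightarrow> t \<in> X \<Longrightarrow> \<forall>\<^sub>F s in at t. s \<in> X" for X
    proof (subst open_subopen, intro ballI)
      fix t assume t: "t \<in> J \<inter> X"
      then have "\<forall>\<^sub>F s in nhds t. s \<in> X" using that[of t] by (simp add: eventually_nhds_conv_at)
      then obtain S where "open S" "t \<in> S" "\<forall>s\<in>S. s \<in> X" by (auto simp: eventually_nhds)
      then show "\<exists>T. open T \<and> t \<in> T \<and> T \<subseteq> J \<inter> X"
        using t by (intro exI[of _ "S \<inter> J"]) (auto simp: J_def)
    qed
    show "open (J \<inter> A)" "open (J \<inter> B)" using oo openA openB by blast+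
  qed
  have "connected J" by (simp add: J_def)
  moreover have "J \<subseteq> (J \<inter> A) \<union> (J \<inter> B)" "(J \<inter> A) \<inter> (J \<inter> B) \<inter> J = {}"
    using cover disj by blast+
  ultimately have "(J \<inter> A) \<inter> J = {} \<or> (J \<inter> B) \<inter> J = {}"
    using JAB connectedD by blast
  then consider "\<And>t. t \<in> J \<Longrightarrow> t \<in> A" | "\<And>t. t \<in> J \<Longrightarrow> t \<in> B" using cover by blast
  then show False
  proof cases
    case 1
    have "\<exists>y\<in>{x0<..<x0 + d}. F y = c (x0 - e + d)" if "0 < d" "d < 2 * e" for d
      using 1[of "x0 - e + d"] that by (force simp: A_def J_def)
    then have ex: "\<forall>\<^sub>F d in at_right 0. \<exists>y\<in>{x0<..<x0 + d}. F y = c (x0 - e + d)"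
      unfolding eventually_at_right_field using e by (intro exI[of _ "2 * e"]) auto
    have "F x0 > c (x0 - e)" using x0 e by (intro big) auto
    then obtain m where m: "c (x0 - e) < m" "m < F x0" using dense by blast
    have "((\<lambda>d. c (x0 - e + d)) \<longlongrightarrow> c (x0 - e + 0)) (at_right 0)"
      by (intro isCont_tendsto_compose[OF cc] tendsto_intros)
    then have e1: "\<forall>\<^sub>F d in at_right 0. c (x0 - e + d) < m" using m order_tendstoD(2) by fastforce
    have "isCont F x0" using F by (simp add: continuous_on_eq_continuous_at)
    then obtain \<delta> where \<delta>: "\<delta> > 0" "\<And>y. \<bar>y - x0\<bar> < \<delta> \<Longrightarrow> \<bar>F y - F x0\<bar> < F x0 - m"
      using m unfolding continuous_at_eps_delta dist_real_def by (metis diff_gt_0_iff_gt)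
    have e2: "\<forall>\<^sub>F d in at_right 0. d < \<delta>"
      unfolding eventually_at_right_field using \<delta>(1) by blast
    obtain d where d: "\<exists>y\<in>{x0<..<x0 + d}. F y = c (x0 - e + d)" "c (x0 - e + d) < m" "d < \<delta>"
      using eventually_happens'[OF trivial_limit_at_right_real eventually_conj[OF ex eventually_conj[OF e1 e2]]] by blast
    then obtain y where y: "x0 < y" "y < x0 + d" "F y = c (x0 - e + d)" by auto
    have "\<bar>F y - F x0\<bar> < F x0 - m" using y d by (intro \<delta>) auto
    then show False using y d by linarith
  next
    case 2
    have "\<exists>y\<in>{x0 - d<..<x0}. F y = c (x0 + e - d)" if "0 < d" "d < 2 * e" for d
      using 2[of "x0 + e - d"] that by (force simp: B_def J_def)
    then have ex: "\<forall>\<^sub>F d in at_right 0. \<exists>y\<in>{x0 - d<..<x0}. F y = c (x0 + e - d)"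
      unfolding eventually_at_right_field using e by (intro exI[of _ "2 * e"]) auto
    have "F x0 > c (x0 + e)" using x0 e by (intro big) auto
    then obtain m where m: "c (x0 + e) < m" "m < F x0" using dense by blast
    have "((\<lambda>d. c (x0 + e - d)) \<longlongrightarrow> c (x0 + e - 0)) (at_right 0)"
      by (intro isCont_tendsto_compose[OF cc] tendsto_intros)
    then have e1: "\<forall>\<^sub>F d in at_right 0. c (x0 + e - d) < m" using m order_tendstoD(2) by fastforce
    have "isCont F x0" using F by (simp add: continuous_on_eq_continuous_at)
    then obtain \<delta> where \<delta>: "\<delta> > 0" "\<And>y. \<bar>y - x0\<bar> < \<delta> \<Longrightarrow> \<bar>F y - F x0\<bar> < F x0 - m"
      using m unfolding continuous_at_eps_delta dist_real_def by (metis diff_gt_0_iff_gt)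
    have e2: "\<forall>\<^sub>F d in at_right 0. d < \<delta>"
      unfolding eventually_at_right_field using \<delta>(1) by blast
    obtain d where d: "\<exists>y\<in>{x0 - d<..<x0}. F y = c (x0 + e - d)" "c (x0 + e - d) < m" "d < \<delta>"
      using eventually_happens'[OF trivial_limit_at_right_real eventually_conj[OF ex eventually_conj[OF e1 e2]]] by blast
    then obtain y where y: "x0 - d < y" "y < x0" "F y = c (x0 + e - d)" by auto
    have "\<bar>F y - F x0\<bar> < F x0 - m" using y d by (intro \<delta>) auto
    then show False using y d by linarith
  qed
qed

section \<open>Bounded solutions and the spectrum\<close>
lemma primitive_on_UNIV_continuous:
  assumes "primitive_on UNIV u f"
  shows "continuous_on UNIV u"
  unfolding continuous_on_eq_continuous_at[OF open_UNIV]
proof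
  fix x :: real
  have "continuous_on {x-1..x+1} u"
    by (rule primitive_on_continuous, rule primitive_on_subset[OF assms]) simp
  then show "isCont u x"
    by (rule continuous_on_interior) simp
qed

lemma cvec_scaleR_nth: "(r *\<^sub>R (v :: complex ^ 2)) $ i = of_real r * v $ i"
  by (subst vector_scaleR_component) (simp add: scaleR_conv_of_real)

lemma borel_measurable_bounded_linear:
  "bounded_linear f \<Longrightarrow> g \<in> borel_measurable M \<Longrightarrow> (\<lambda>x. f (g x)) \<in> borel_measurable M"
  by (rule measurable_compose[OF _ borel_measurable_continuous_onI[OF linear_continuous_on]])

definition sqnorm :: "vfun \<Rightarrow> real" where
  "sqnorm y = (\<integral>x. (norm (y x))\<^sup>2 \<partial>lebesgue)"

lemma sqnorm_nonneg: "0 \<le> sqnorm y" by (simp add: sqnorm_def)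

lemma L2norm_UNIV: "L2norm UNIV y = sqrt (sqnorm y)"
  by (simp add: L2norm_def sqnorm_def lebesgue_on_UNIV_eq)

lemma square_integrable_UNIV:
  "square_integrable UNIV y \<longleftrightarrow>
     y \<in> borel_measurable lebesgue \<and> integrable lebesgue (\<lambda>x. (norm (y x))\<^sup>2)"
  by (simp add: square_integrable_def lebesgue_on_UNIV_eq)

lemma square_integrable_compact_support:
  assumes m: "y \<in> borel_measurable lebesgue" and ab: "a \<le> b" and B: "0 \<le> B"
    and bd: "\<And>x. x \<in> {a..b} \<Longrightarrow> norm (y x) \<le> B" and z: "\<And>x. x \<notin> {a..b} \<Longrightarrow> y x = 0"
  shows "square_integrable UNIV y" "sqnorm y \<le> B\<^sup>2 * (b - a)"
proof -
  have le: "(norm (y x))\<^sup>2 \<le> B\<^sup>2 * indicator {a..b} x" for x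
    using bd[of x] z[of x] by (cases "x \<in> {a..b}") (auto intro!: power_mono)
  have i: "integrable lebesgue (\<lambda>x. B\<^sup>2 * indicator {a..b} x :: real)"
    by (intro integrable_mult_right integrable_real_indicator) (auto simp: emeasure_lborel_Icc_eq)
  have y: "integrable lebesgue (\<lambda>x. (norm (y x))\<^sup>2)"
    by (rule Bochner_Integration.integrable_bound[OF i]) (use m le in auto)
  then show "square_integrable UNIV y" using m by (simp add: square_integrable_UNIV)
  have "sqnorm y \<le> (\<integral>x. B\<^sup>2 * indicator {a..b} x \<partial>lebesgue)"
    unfolding sqnorm_def by (rule integral_mono[OF y i le])
  also have "\<dots> = B\<^sup>2 * (b - a)" using ab by simp
  finally show "sqnorm y \<le> B\<^sup>2 * (b - a)" .
qed

lemma sqnorm_ge: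
  assumes sq: "square_integrable UNIV y" and ab: "a \<le> b" and c: "0 \<le> c"
    and bd: "\<And>x. x \<in> {a..b} \<Longrightarrow> c \<le> norm (y x)"
  shows "c\<^sup>2 * (b - a) \<le> sqnorm y"
proof -
  have i: "integrable lebesgue (\<lambda>x. c\<^sup>2 * indicator {a..b} x :: real)"
    by (intro integrable_mult_right integrable_real_indicator) (auto simp: emeasure_lborel_Icc_eq)
  have "c\<^sup>2 * (b - a) = (\<integral>x. c\<^sup>2 * indicator {a..b} x \<partial>lebesgue)" using ab by simp
  also have "\<dots> \<le> sqnorm y"
    unfolding sqnorm_def
    by (rule integral_mono[OF i]) (use sq bd c in \<open>auto simp: square_integrable_UNIV indicator_def intro!: power_mono\<close>)
  finally show ?thesis .
qed

lemma primitive_on_abs: "primitive_on UNIV (\<lambda>x::real. \<bar>x\<bar>) sgn"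
  unfolding primitive_on_def
proof (intro allI impI conjI)
  fix a b :: real assume ab: "a \<le> b \<and> {a..b} \<subseteq> UNIV"
  show i: "(sgn has_integral \<bar>b\<bar> - \<bar>a\<bar>) {a..b}"
  proof (rule fundamental_theorem_of_calculus_interior_strong[of "{0}"])
    fix x :: real assume x: "x \<in> {a<..<b} - {0}"
    show "(abs has_vector_derivative sgn x) (at x)"
    proof (cases "x > 0")
      case True
      show ?thesis
        by (rule has_vector_derivative_transform_within_open[of "\<lambda>x. x" _ _ "{0<..}"])
          (use True in \<open>auto simp: has_vector_derivative_id\<close>)
    next
      case False
      show ?thesis
        by (rule has_vector_derivative_transform_within_open[of "\<lambda>x. - x" _ _ "{..<0}"])
          (use False x in \<open>auto intro!: derivative_eq_intros\<close>)
    qed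
  qed (use ab in \<open>auto intro!: continuous_intros\<close>)
  show "sgn absolutely_integrable_on {a..b}"
    by (rule absolutely_integrable_integrable_bound[of _ _ "\<lambda>_. 1"])
      (use i in \<open>auto simp: sgn_real_def\<close>)
qed

text \<open>
  The piecewise linear function with slope one on \<open>[0, L / 2]\<close>, slope minus one on \<open>[L / 2, L]\<close> and the
  value zero elsewhere.  Written through absolute values it inherits its primitive from that of \<open>sgn\<close>.
\<close>
definition tent :: "real \<Rightarrow> real \<Rightarrow> real" where
  "tent L x = (\<bar>x\<bar> + \<bar>x - L\<bar> - 2 * \<bar>x - L / 2\<bar>) / 2"

definition tent_slope :: "real \<Rightarrow> real \<Rightarrow> real" where
  "tent_slope L x = (sgn x + sgn (x - L) - 2 * sgn (x - L / 2)) / 2"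

lemma primitive_on_tent: "primitive_on UNIV (tent L) (tent_slope L)"
proof -
  have s: "primitive_on UNIV (\<lambda>x. r * \<bar>x + c\<bar>) (\<lambda>x. r * sgn (x + c))" for c r :: real
    using primitive_on_bounded_linear[OF bounded_linear_mult_right primitive_on_shift[OF primitive_on_abs]] .
  show ?thesis
    by (rule primitive_on_cong[OF primitive_on_add[OF primitive_on_add[OF s[of "1/2" 0] s[of "1/2" "- L"]] s[of "-1" "- L / 2"]]])
      (auto simp: tent_def tent_slope_def field_simps)
qed

lemma tent_facts:
  assumes "L > 0"
  shows "x \<notin> {0..L} \<Longrightarrow> tent L x = 0" "x \<notin> {0..L} \<Longrightarrow> tent_slope L x = 0"
    "\<bar>tent_slope L x\<bar> \<le> 1" "x \<in> {L / 4..3 * L / 4} \<Longrightarrow> L / 4 \<le> tent L x"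
    "0 \<le> tent L x" "tent L x \<le> L"
  using assms by (auto simp: tent_def tent_slope_def sgn_real_def abs_if split: if_splits)

lemma borel_measurable_tent_slope: "tent_slope L \<in> borel_measurable borel"
  unfolding tent_slope_def[abs_def] sgn_real_def by measurable

context dirac_periodic
begin

text \<open>
  Along the half line the norm of the solution is periodic, and it never vanishes since \<open>E x z\<close> is
  invertible; so its extrema over one period are bounds.
\<close>
lemma bloch_solution_bounds:
  assumes v: "v \<noteq> 0" and u: "E pi z *v v = u *s v" "cmod u = 1"
  obtains c B where "0 < c" "\<And>x. 0 \<le> x \<Longrightarrow> c \<le> norm (E x z *v v) \<and> norm (E x z *v v) \<le> B"
proof -
  define y where "y x = E x z *v v" for x
  have nz: "y x \<noteq> 0" for x
    using det_eq_0_iff_kernel[of "E x z"] v det_E[of x z] by (auto simp: y_def)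
  have step: "norm (y (x + pi)) = norm (y x)" if "x \<ge> 0" for x
  proof -
    have "E x z *v (u *s v) = u *s (E x z *v v)"
      by (simp add: vec_eq_iff matrix_vector_mult_def sum_2 algebra_simps)
    then show ?thesis using E_add_pi[OF that, of z v] u by (simp add: y_def norm_cscale)
  qed
  have steps: "norm (y (x + real n * pi)) = norm (y x)" if "x \<ge> 0" for x n
  proof (induction n)
    case (Suc n)
    have "x + real (Suc n) * pi = (x + real n * pi) + pi" by (simp add: algebra_simps)
    with Suc step[of "x + real n * pi"] that show ?case by (simp only:) simp
  qed simp
  have "continuous_on {0..pi} (\<lambda>x. norm (y x))"
    unfolding y_def using primitive_on_UNIV_continuous[OF primitive_on_E_mult]
    by (intro continuous_intros) (auto intro: continuous_on_subset)
  moreover have "compact {0..pi}" "{0..pi} \<noteq> {}" by auto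
  ultimately obtain p q where p: "\<And>x. x \<in> {0..pi} \<Longrightarrow> norm (y p) \<le> norm (y x)"
    and q: "\<And>x. x \<in> {0..pi} \<Longrightarrow> norm (y x) \<le> norm (y q)"
    using continuous_attains_inf continuous_attains_sup by meson
  have "norm (y p) \<le> norm (y x) \<and> norm (y x) \<le> norm (y q)" if "x \<ge> 0" for x
  proof -
    define n where "n = nat \<lfloor>x / pi\<rfloor>"
    define r where "r = x - real n * pi"
    have "real n = of_int \<lfloor>x / pi\<rfloor>" using that by (simp add: n_def)
    then have "real n \<le> x / pi" "x / pi < real n + 1" by linarith+
    then have "r \<in> {0..pi}" by (simp add: r_def field_simps)
    moreover have "norm (y x) = norm (y r)" using steps[of r n] \<open>r \<in> {0..pi}\<close> by (simp add: r_def)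
    ultimately show ?thesis using p q by simp
  qed
  then show ?thesis using that[of "norm (y p)" "norm (y q)"] nz[of p] by (simp add: y_def)
qed

text \<open>
  Multiply the solution by a tent of width \<open>L\<close>.  The product has squared norm of order \<open>L ^ 3\<close>, while
  the operator minus \<open>z\<close> maps it to \<open>J\<close> times the slope of the tent times the solution, of
  squared norm of order \<open>L\<close>.  No constant can bound the first by the second for all \<open>L\<close>.
\<close>
lemma bloch_solution_spectrum:
  assumes v: "v \<noteq> 0" and u: "E pi z *v v = u *s v" "cmod u = 1"
  shows "z \<in> spectrum UNIV (dirac_L (Pmat p2 p3))"
proof (rule ccontr)
  assume "z \<notin> spectrum UNIV (dirac_L (Pmat p2 p3))"
  then obtain C where C: "\<And>y h. (y, h) \<in> dirac_op UNIV (Pmat p2 p3) \<Longrightarrow>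
      L2norm UNIV y \<le> C * L2norm UNIV (h - cscale z y)"
    unfolding spectrum_def resolvent_set_def dirac_L_def by fastforce
  obtain c B where c: "0 < c" and cB: "\<And>x. 0 \<le> x \<Longrightarrow> c \<le> norm (E x z *v v) \<and> norm (E x z *v v) \<le> B"
    using bloch_solution_bounds[OF assms] by blast
  have B: "B > 0" using c cB[of 0] by linarith
  define y where "y x = E x z *v v" for x
  have py: "primitive_on UNIV y (rhs y (\<lambda>x. z *s y x))"
    unfolding y_def by (rule primitive_on_E_mult)
  have my: "y \<in> borel_measurable lebesgue"
    using primitive_on_UNIV_continuous[OF py]
    by (intro measurable_completion) (simp add: borel_measurable_continuous_onI)
  have key: "c\<^sup>2 * L\<^sup>2 \<le> 32 * C\<^sup>2 * B\<^sup>2" if L: "L > 0" for L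
  proof -
    note tf = tent_facts[OF L]
    define w :: vfun where
      "w x = vector [- \<i> * of_real (tent_slope L x) * y x $ 1, \<i> * of_real (tent_slope L x) * y x $ 2]" for x
    define f where "f x = tent L x *\<^sub>R y x" for x
    define h where "h x = z *s f x + w x" for x
    have nw: "norm (w x) = \<bar>tent_slope L x\<bar> * norm (y x)" for x
      by (simp add: norm_vec2 w_def norm_mult power_mult_distrib real_sqrt_mult flip: distrib_left)
    have pf: "primitive_on UNIV f (rhs f h)"
      unfolding f_def
      by (rule primitive_on_cong[OF primitive_on_product[OF bounded_bilinear_scaleR primitive_on_tent py]])
        (auto simp: vec_eq_iff forall_2 h_def f_def w_def cvec_scaleR_nth algebra_simps simp del: vector_scaleR_component)
    have mt: "tent L \<in> borel_measurable lebesgue" "tent_slope L \<in> borel_measurable lebesgue"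
      using primitive_on_UNIV_continuous[OF primitive_on_tent, of L] borel_measurable_tent_slope[of L]
      by (auto intro!: measurable_completion simp: borel_measurable_continuous_onI)
    have mf: "f \<in> borel_measurable lebesgue"
      unfolding f_def using mt my by measurable
    have mw: "w \<in> borel_measurable lebesgue"
    proof -
      have j: "bounded_linear (\<lambda>v :: complex ^ 2. vector [- \<i> * v $ 1, \<i> * v $ 2] :: complex ^ 2)"
        by (rule bounded_linear_intro[where K = 1])
          (auto simp: vec_eq_iff forall_2 norm_vec2 norm_mult algebra_simps)
      have "w = (\<lambda>x. (\<lambda>v. vector [- \<i> * v $ 1, \<i> * v $ 2]) (tent_slope L x *\<^sub>R y x))"
        by (auto simp: w_def fun_eq_iff vec_eq_iff forall_2 cvec_scaleR_nth simp del: vector_scaleR_component)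
      moreover have "(\<lambda>x. tent_slope L x *\<^sub>R y x) \<in> borel_measurable lebesgue"
        using mt my by measurable
      ultimately show ?thesis
        by (simp only: borel_measurable_bounded_linear[OF j])
    qed
    have sf: "square_integrable UNIV f"
    proof (rule square_integrable_compact_support(1)[OF mf, of 0 L "L * B"])
      fix x assume x: "x \<in> {0..L}"
      then show "norm (f x) \<le> L * B"
        using cB[of x] tf(5,6)[of x] L B by (auto simp: f_def y_def intro!: mult_mono)
    qed (use L B tf(1) in \<open>auto simp: f_def\<close>)
    have sw: "square_integrable UNIV w \<and> sqnorm w \<le> B\<^sup>2 * (L - 0)"
    proof -
      have "norm (w x) \<le> B" if "x \<in> {0..L}" for x
        using cB[of x] tf(3)[of x] that mult_mono[of "\<bar>tent_slope L x\<bar>" 1 "norm (y x)" B] by (auto simp: nw y_def)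
      moreover have "w x = 0" if "x \<notin> {0..L}" for x
        using tf(2)[OF that] nw[of x] by simp
      ultimately show ?thesis
        using square_integrable_compact_support[OF mw, of 0 L B] L B by auto
    qed
    have sh: "square_integrable UNIV h"
    proof (rule square_integrable_compact_support(1)[of _ 0 L "cmod z * (L * B) + B"])
      show "h \<in> borel_measurable lebesgue"
        unfolding h_def using mf mw borel_measurable_bounded_linear[OF bounded_linear_cscale]
        by (intro borel_measurable_add) auto
      fix x
      assume x: "x \<in> {0..L}"
      have "norm (f x) \<le> L * B" "norm (w x) \<le> B"
        using cB[of x] tf(3,5,6)[of x] x L B mult_mono[of "\<bar>tent_slope L x\<bar>" 1 "norm (y x)" B]
        by (auto simp: f_def nw y_def intro!: mult_mono)
      then have "cmod z * norm (f x) \<le> cmod z * (L * B)" "norm (w x) \<le> B"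
        by (auto intro!: mult_left_mono)
      then show "norm (h x) \<le> cmod z * (L * B) + B"
        unfolding h_def using norm_triangle_ineq[of "z *s f x" "w x"] by (simp add: norm_cscale)
    next
      fix x assume "x \<notin> {0..L}"
      then show "h x = 0" using tf(1,2)[of x] nw[of x] by (simp add: h_def f_def)
    qed (use L B in auto)
    have "(f, h) \<in> dirac_op UNIV (Pmat p2 p3)"
      using sf sh pf by (simp add: dirac_op_iff)
    from C[OF this] have "L2norm UNIV f \<le> C * L2norm UNIV w"
      by (simp add: h_def cscale_def fun_diff_def)
    then have "sqrt (sqnorm f) \<le> \<bar>C\<bar> * sqrt (sqnorm w)"
      unfolding L2norm_UNIV
      by (rule order_trans) (auto intro!: mult_right_mono simp: sqnorm_nonneg)
    then have "(sqrt (sqnorm f))\<^sup>2 \<le> (\<bar>C\<bar> * sqrt (sqnorm w))\<^sup>2"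
      by (intro power_mono) (auto simp: sqnorm_nonneg)
    then have "sqnorm f \<le> C\<^sup>2 * sqnorm w"
      by (simp add: power_mult_distrib sqnorm_nonneg)
    also have "\<dots> \<le> C\<^sup>2 * (B\<^sup>2 * L)" using sw by (intro mult_left_mono) auto
    finally have up: "sqnorm f \<le> C\<^sup>2 * (B\<^sup>2 * L)" .
    have "(L / 4 * c)\<^sup>2 * (3 * L / 4 - L / 4) \<le> sqnorm f"
    proof (rule sqnorm_ge[OF sf])
      fix x assume x: "x \<in> {L / 4..3 * L / 4}"
      have "c \<le> norm (y x)" unfolding y_def using cB[of x] x L by auto
      then have "L / 4 * c \<le> tent L x * norm (y x)"
        using tf(4)[OF x] tf(5)[of x] L c by (intro mult_mono) auto
      then show "L / 4 * c \<le> norm (f x)" using tf(5)[of x] by (simp add: f_def)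
    qed (use L c in auto)
    with up have "(L / 4 * c)\<^sup>2 * (L / 2) \<le> C\<^sup>2 * (B\<^sup>2 * L)" by (simp add: field_simps)
    then have "L * (c\<^sup>2 * L\<^sup>2) \<le> L * (32 * C\<^sup>2 * B\<^sup>2)"
      by (simp add: power2_eq_square field_simps)
    then show ?thesis using L by simp
  qed
  \<comment> \<open>a width for which \<open>c\<^sup>2 L\<^sup>2 = 36 (\<bar>C\<bar> + 1)\<^sup>2 B\<^sup>2\<close> exceeds \<open>32 C\<^sup>2 B\<^sup>2\<close>\<close>
  define L where "L = 6 * (\<bar>C\<bar> + 1) * B / c"
  have "c * L = 6 * ((\<bar>C\<bar> + 1) * B)"
    using c by (simp add: L_def field_simps)
  then have "(c * L)\<^sup>2 = (6 * ((\<bar>C\<bar> + 1) * B))\<^sup>2" by (rule arg_cong)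
  then have "c\<^sup>2 * L\<^sup>2 = 36 * ((\<bar>C\<bar> + 1)\<^sup>2 * B\<^sup>2)"
    by (simp only: power_mult_distrib) simp
  moreover have "C\<^sup>2 * B\<^sup>2 < (\<bar>C\<bar> + 1)\<^sup>2 * B\<^sup>2"
    using B by (intro mult_strict_right_mono) (auto simp: power2_eq_square algebra_simps)
  moreover have "0 \<le> C\<^sup>2 * B\<^sup>2" by simp
  moreover have "L > 0" using B c by (simp add: L_def)
  ultimately show False using key[of L] by linarith
qed

lemma discr_in_band_spectrum:
  assumes "discr z = of_real r" "\<bar>r\<bar> \<le> 2"
  shows "z \<in> spectrum UNIV (dirac_L (Pmat p2 p3))"
proof -
  define t where "t = arccos (r / 2) / pi"
  have "discr z = of_real (2 * cos (pi * t))" using assms by (simp add: t_def cos_arccos_abs)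
  then have "det (E pi z - mat (exp (\<i> * of_real (pi * t)))) = 0"
    by (rule iffD2[OF det_multiplier_eq_0_iff])
  then obtain v where v: "v \<noteq> 0" "(E pi z - mat (exp (\<i> * of_real (pi * t)))) *v v = 0"
    unfolding det_eq_0_iff_kernel by blast
  have "(E pi z - mat u) *v v = E pi z *v v - u *s v" for u
    by (simp add: vec_eq_iff forall_2 matrix_vector_mult_def sum_2 mat_def algebra_simps)
  with v show ?thesis
    using bloch_solution_spectrum[of v z "exp (\<i> * of_real (pi * t))"] by (simp add: norm_exp_i_times)
qed

end

section \<open>The spectrum is closed\<close>
lemma norm_add_squared_le:
  "(norm (a + b))\<^sup>2 \<le> 2 * (norm (a :: 'a::real_normed_vector))\<^sup>2 + 2 * (norm b)\<^sup>2"
proof -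
  have "(norm (a + b))\<^sup>2 \<le> (norm a + norm b)\<^sup>2"
    by (intro power_mono norm_triangle_ineq) auto
  also have "\<dots> \<le> 2 * (norm a)\<^sup>2 + 2 * (norm b)\<^sup>2"
    using sum_squares_ge_zero[of "norm a - norm b" 0] by (simp add: power2_eq_square algebra_simps)
  finally show ?thesis .
qed

lemma square_integrable_add:
  assumes "square_integrable UNIV y" "square_integrable UNIV w"
  shows "square_integrable UNIV (\<lambda>x. y x + w x)" "sqnorm (\<lambda>x. y x + w x) \<le> 2 * sqnorm y + 2 * sqnorm w"
proof -
  have m: "y \<in> borel_measurable lebesgue" "w \<in> borel_measurable lebesgue"
    and i: "integrable lebesgue (\<lambda>x. 2 * (norm (y x))\<^sup>2 + 2 * (norm (w x))\<^sup>2)"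
    using assms by (auto simp: square_integrable_UNIV)
  have m': "(\<lambda>x. y x + w x) \<in> borel_measurable lebesgue" using m by measurable
  have s: "integrable lebesgue (\<lambda>x. (norm (y x + w x))\<^sup>2)"
    by (rule Bochner_Integration.integrable_bound[OF i])
      (use m' in \<open>auto simp: norm_add_squared_le\<close>)
  then show "square_integrable UNIV (\<lambda>x. y x + w x)" using m' by (simp add: square_integrable_UNIV)
  have "sqnorm (\<lambda>x. y x + w x) \<le> (\<integral>x. 2 * (norm (y x))\<^sup>2 + 2 * (norm (w x))\<^sup>2 \<partial>lebesgue)"
    unfolding sqnorm_def by (rule integral_mono[OF s i norm_add_squared_le])
  also have "\<dots> = 2 * sqnorm y + 2 * sqnorm w"
    using assms by (simp add: sqnorm_def square_integrable_UNIV)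
  finally show "sqnorm (\<lambda>x. y x + w x) \<le> 2 * sqnorm y + 2 * sqnorm w" .
qed

lemma square_integrable_cscale:
  assumes "square_integrable UNIV y"
  shows "square_integrable UNIV (\<lambda>x. c *s y x)" "sqnorm (\<lambda>x. c *s y x) = (cmod c)\<^sup>2 * sqnorm y"
  using assms borel_measurable_bounded_linear[OF bounded_linear_cscale, of y lebesgue c]
  by (auto simp: square_integrable_UNIV sqnorm_def norm_cscale power_mult_distrib)

lemma square_integrable_diff_cscale:
  assumes "square_integrable UNIV h" "square_integrable UNIV y"
  shows "square_integrable UNIV (\<lambda>x. h x - c *s y x)"
  using square_integrable_add(1)[OF assms(1) square_integrable_cscale(1)[OF assms(2), of "- c"]]
  by (simp add: vec_eq_iff algebra_simps)

lemma dirac_op_add: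
  assumes "(y1, h1) \<in> dirac_op UNIV (Pmat p2 p3)" "(y2, h2) \<in> dirac_op UNIV (Pmat p2 p3)"
  shows "(\<lambda>x. y1 x + y2 x, \<lambda>x. h1 x + h2 x) \<in> dirac_op UNIV (Pmat p2 p3)"
  using assms dirac_solution_add square_integrable_add(1) by (fastforce simp: dirac_op_iff)

lemma dirac_op_cscale:
  assumes "(y, h) \<in> dirac_op UNIV (Pmat p2 p3)"
  shows "(\<lambda>x. c *s y x, \<lambda>x. c *s h x) \<in> dirac_op UNIV (Pmat p2 p3)"
  using assms dirac_solution_cscale square_integrable_cscale(1) by (fastforce simp: dirac_op_iff)

lemma dirac_op_cong_AE:
  assumes "(y, h) \<in> dirac_op UNIV P" "square_integrable UNIV h'" "AE x in lebesgue. h x = h' x"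
  shows "(y, h') \<in> dirac_op UNIV P"
  using assms unfolding dirac_op_def dirac_expr_def lebesgue_on_UNIV_eq
  by (auto elim!: eventually_elim2)

context dirac_potential
begin

abbreviation L :: "(vfun \<times> vfun) set" where "L \<equiv> dirac_L (Pmat p2 p3)"

lemma L_iff: "(y, h) \<in> L \<longleftrightarrow> square_integrable UNIV y \<and> square_integrable UNIV h \<and> primitive_on UNIV y (rhs y h)"
  by (simp add: dirac_L_def dirac_op_iff)

text \<open>
  On \<open>[- R - 1, - R]\<close> the function cannot be large everywhere without exceeding its norm, so it is at
  most \<open>2 s\<close> at some point; from there the Gronwall inequality carries the bound to \<open>[- R, R]\<close>.
  The forcing enters through \<open>norm h \<le> (s + (norm h)\<^sup>2 / s) / 2\<close>, whose integral over a bounded interval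
  is controlled by the squared norm of \<open>h\<close>.
\<close>
lemma L_pointwise_bound:
  assumes R: "R \<ge> 0"
  obtains K where "K \<ge> 0" "\<And>y h s x. (y, h) \<in> L \<Longrightarrow> s > 0 \<Longrightarrow> sqnorm y \<le> s\<^sup>2 \<Longrightarrow> sqnorm h \<le> s\<^sup>2 \<Longrightarrow>
    x \<in> {- R..R} \<Longrightarrow> norm (y x) \<le> K * s"
proof
  define X where "X = exp (2 * integral {- R - 1..R} pot)"
  show "(2 * R + 4) * X \<ge> 0" using R by (simp add: X_def)
  fix y h s x
  assume L: "(y, h) \<in> L" and s: "s > 0" and sy: "sqnorm y \<le> s\<^sup>2" and sh: "sqnorm h \<le> s\<^sup>2" and x: "x \<in> {- R..R}"
  have sq: "square_integrable UNIV y" "square_integrable UNIV h" and p: "primitive_on UNIV y (rhs y h)"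
    using L by (auto simp: L_iff)
  have "\<exists>x0\<in>{- R - 1..- R}. norm (y x0) \<le> 2 * s"
  proof (rule ccontr)
    assume neg: "\<not> ?thesis"
    have "(2 * s)\<^sup>2 * (- R - (- R - 1)) \<le> sqnorm y"
      by (rule sqnorm_ge[OF sq(1)]) (use s neg in \<open>auto simp: not_le intro!: less_imp_le\<close>)
    moreover have "s\<^sup>2 > 0" using s by simp
    ultimately show False using sy by (simp add: power_mult_distrib)
  qed
  then obtain x0 where x0: "x0 \<in> {- R - 1..- R}" "norm (y x0) \<le> 2 * s" by blast
  define q where "q x = (norm (h x))\<^sup>2" for x
  have qabs: "q absolutely_integrable_on UNIV"
    using sq(2) by (simp add: square_integrable_UNIV q_def set_integrable_def)
  then have qi: "q integrable_on UNIV" by (simp add: absolutely_integrable_on_def)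
  have qx: "q integrable_on {x0..x}"
    using qabs absolutely_integrable_on_subinterval[where S = UNIV and a = x0 and b = x and f = q] by (simp add: absolutely_integrable_on_def)
  have "integral {x0..x} q \<le> integral UNIV q"
    by (rule integral_subset_le[OF _ qx qi]) (auto simp: q_def)
  also have "\<dots> = sqnorm h"
    using set_lebesgue_integral_eq_integral(2)[OF qabs] by (simp add: sqnorm_def q_def set_lebesgue_integral_def)
  finally have iq: "integral {x0..x} q \<le> s\<^sup>2" using sh by simp
  define m where "m x = s / 2 + q x * (1 / (2 * s))" for x
  have mi: "m integrable_on {x0..x}"
    unfolding m_def by (intro integrable_add integrable_on_mult_left qx) auto
  have x0x: "x0 \<le> x" using x0 x by auto
  have "integral {x0..x} m = s / 2 * (x - x0) + integral {x0..x} q * (1 / (2 * s))"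
    unfolding m_def using x0x
    by (subst Henstock_Kurzweil_Integration.integral_add[OF integrable_const_ivl integrable_on_mult_left[OF qx]]) simp
  also have "\<dots> \<le> s / 2 * (2 * R + 1) + s\<^sup>2 * (1 / (2 * s))"
    using s x0 x iq by (intro add_mono mult_left_mono mult_right_mono) auto
  also have "\<dots> = s * (R + 1)" using s by (simp add: power2_eq_square field_simps)
  finally have im: "integral {x0..x} m \<le> s * (R + 1)" .
  have hm: "norm (h x) \<le> m x" for x
  proof -
    have "0 \<le> (norm (h x) - s)\<^sup>2" by simp
    then have "2 * s * norm (h x) \<le> s * s + q x"
      by (simp add: q_def power2_eq_square algebra_simps)
    also have "\<dots> = 2 * s * m x" using s by (simp add: m_def field_simps)
    finally show ?thesis using s by simp
  qed
  have m0: "0 \<le> m x" for x using s by (simp add: m_def q_def)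
  have "norm (y x) \<le> (norm (y x0) + 2 * integral {x0..x} m) * exp (2 * (integral {x0..x} pot + 2 * 0 * (x - x0)))"
    by (rule dirac_gronwall[OF x0x primitive_on_subset[OF p]]) (use mi hm m0 in auto)
  also have "\<dots> \<le> (2 * s + 2 * (s * (R + 1))) * X"
  proof (rule mult_mono)
    have "integral {x0..x} pot \<le> integral {- R - 1..R} pot"
      by (rule integral_subset_le) (use x0 x pot_nonneg pot_integrable in auto)
    then show "exp (2 * (integral {x0..x} pot + 2 * 0 * (x - x0))) \<le> X" by (simp add: X_def)
  qed (use x0 im s R in auto)
  also have "\<dots> = (2 * R + 4) * X * s" by (simp add: algebra_simps)
  finally show "norm (y x) \<le> (2 * R + 4) * X * s" .
qed

lemma resolvent_setD:
  assumes "z0 \<in> resolvent_set UNIV L"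
  obtains C where "C > 0" "\<And>y h. (y, h) \<in> L \<Longrightarrow> sqnorm y \<le> C\<^sup>2 * sqnorm (\<lambda>x. h x - z0 *s y x)"
proof -
  have "\<exists>C. \<forall>(y, h)\<in>L. L2norm UNIV y \<le> C * L2norm UNIV (h - cscale z0 y)"
    using assms unfolding resolvent_set_def by blast
  then obtain C where C0: "\<forall>(y, h)\<in>L. L2norm UNIV y \<le> C * L2norm UNIV (h - cscale z0 y)" ..
  have C: "L2norm UNIV y \<le> C * L2norm UNIV (h - cscale z0 y)" if "(y, h) \<in> L" for y h
    using bspec[OF C0 that] by simp
  have "sqnorm y \<le> (\<bar>C\<bar> + 1)\<^sup>2 * sqnorm (\<lambda>x. h x - z0 *s y x)" if "(y, h) \<in> L" for y h
  proof -
    have "sqrt (sqnorm y) \<le> C * sqrt (sqnorm (\<lambda>x. h x - z0 *s y x))"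
      using C[OF that] by (simp add: L2norm_UNIV cscale_def fun_diff_def)
    also have "\<dots> \<le> (\<bar>C\<bar> + 1) * sqrt (sqnorm (\<lambda>x. h x - z0 *s y x))"
      by (intro mult_right_mono) (auto simp: sqnorm_nonneg)
    finally have "(sqrt (sqnorm y))\<^sup>2 \<le> ((\<bar>C\<bar> + 1) * sqrt (sqnorm (\<lambda>x. h x - z0 *s y x)))\<^sup>2"
      by (intro power_mono) (auto simp: sqnorm_nonneg)
    then show ?thesis by (simp add: power_mult_distrib sqnorm_nonneg)
  qed
  then show ?thesis using that[of "\<bar>C\<bar> + 1"] by simp
qed

lemma resolvent_set_solve:
  assumes "z0 \<in> resolvent_set UNIV L" "square_integrable UNIV g"
  shows "\<exists>y. (y, \<lambda>x. z0 *s y x + g x) \<in> L"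
proof -
  obtain y h where yh: "(y, h) \<in> L" "AE x in lebesgue. h x - z0 *s y x = g x"
    using assms unfolding resolvent_set_def lebesgue_on_UNIV_eq by blast
  then have "square_integrable UNIV y" by (simp add: L_iff)
  then have "square_integrable UNIV (\<lambda>x. z0 *s y x + g x)"
    using assms(2) square_integrable_add(1) square_integrable_cscale(1) by blast
  moreover have "AE x in lebesgue. h x = z0 *s y x + g x"
    using yh(2) by eventually_elim (metis add.commute diff_add_cancel)
  ultimately have "(y, \<lambda>x. z0 *s y x + g x) \<in> L"
    using yh(1) unfolding dirac_L_def by (rule dirac_op_cong_AE[rotated 2, rotated -1])
  then show ?thesis by blast
qed

text \<open>
  A function in the domain that vanishes almost everywhere vanishes identically: both it and zero solve
  the equation with right-hand side zero at a point \<open>z0\<close> of the resolvent set.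
\<close>
lemma L_kernel_trivial:
  assumes z0: "z0 \<in> resolvent_set UNIV L" and d: "(d, h) \<in> L" "sqnorm d = 0" "AE x in lebesgue. h x = z *s d x"
  shows "d = 0"
proof -
  have "AE x in lebesgue. (norm (d x))\<^sup>2 = 0"
    using d(1,2) by (subst integral_nonneg_eq_0_iff_AE[symmetric]) (auto simp: L_iff square_integrable_UNIV sqnorm_def)
  then have "AE x in lebesgue. h x - z0 *s d x = (0 :: vfun) x"
    using d(3) by eventually_elim simp
  moreover have sz: "square_integrable UNIV (0 :: vfun)"
    by (simp add: square_integrable_UNIV zero_fun_def)
  moreover have "(0, 0) \<in> L"
  proof -
    have "(\<lambda>x. 0 *s d x, \<lambda>x. 0 *s h x) \<in> L"
      using dirac_op_cscale[OF d(1)[unfolded dirac_L_def], of 0] unfolding dirac_L_def .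
    then show ?thesis by (simp add: zero_fun_def)
  qed
  moreover have "AE x in lebesgue. (0 :: vfun) x - z0 *s (0 :: vfun) x = (0 :: vfun) x" by simp
  ultimately show "d = 0"
    using z0 d(1) unfolding resolvent_set_def lebesgue_on_UNIV_eq by blast
qed

text \<open>
  The Neumann series for the resolvent at \<open>z0 + \<zeta>\<close>: here \<open>y 0\<close> solves the equation at \<open>z0\<close> for \<open>g\<close>,
  and each \<open>y (Suc n)\<close> solves it for the error \<open>\<zeta> y n\<close> left by the previous terms.  By
  the pointwise bound the sum converges uniformly on bounded intervals, and dominated convergence
  passes the differential equation to the limit.  Square integrability of the limit comes from
  \<open>norm (\<Sum> y k) ^ 2 \<le> \<Sum> 2 ^ (k + 1) * norm (y k) ^ 2\<close>; the weights grow more slowly than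
  the squared norms \<open>S / 16 ^ n\<close> decay.
\<close>
lemma geometric_correction_series:
  assumes it: "\<And>n. (y n, \<lambda>x. z0 *s y n x + f n x) \<in> L"
    and f0: "f 0 = g" and fSuc: "\<And>n. f (Suc n) = (\<lambda>x. \<zeta> *s y n x)"
    and decay: "\<And>n. sqnorm (y n) \<le> S / 16 ^ n"
  shows "\<exists>Y. (Y, \<lambda>x. (z0 + \<zeta>) *s Y x + g x) \<in> L"
proof -
  have sqy: "square_integrable UNIV (y n)" for n using it[of n] by (simp add: L_iff)
  have py: "primitive_on UNIV (y n) (rhs (y n) (\<lambda>x. z0 *s y n x + f n x))" for n
    using it[of n] by (simp add: L_iff)
  have S0: "S \<ge> 0" using decay[of 0] sqnorm_nonneg[of "y 0"] by simp
  have sqg: "square_integrable UNIV g"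
  proof -
    have "square_integrable UNIV (\<lambda>x. z0 *s y 0 x + g x)" using it[of 0] by (simp add: L_iff f0)
    from square_integrable_diff_cscale[OF this sqy[of 0], of z0] show ?thesis by simp
  qed
  \<comment> \<open>chosen so that \<open>M / 4 ^ n\<close> dominates the norms of both \<open>y n\<close> and its image for \<open>n \<ge> 1\<close>\<close>
  define M where "M = sqrt ((2 * (cmod z0)\<^sup>2 + 32 * (cmod \<zeta>)\<^sup>2 + 1) * (S + 1))"
  have M2: "M\<^sup>2 = (2 * (cmod z0)\<^sup>2 + 32 * (cmod \<zeta>)\<^sup>2 + 1) * (S + 1)"
    unfolding M_def using S0 by simp
  have M0: "M > 0" unfolding M_def using S0 by (auto intro!: mult_pos_pos add_nonneg_pos)
  have MS: "S \<le> M\<^sup>2" "2 * (cmod z0)\<^sup>2 * S + 32 * (cmod \<zeta>)\<^sup>2 * S \<le> M\<^sup>2"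
  proof -
    have "0 \<le> (cmod z0)\<^sup>2 * S" "0 \<le> (cmod \<zeta>)\<^sup>2 * S" using S0 by auto
    moreover have "0 \<le> (cmod z0)\<^sup>2" "0 \<le> (cmod \<zeta>)\<^sup>2" by auto
    ultimately show "S \<le> M\<^sup>2" "2 * (cmod z0)\<^sup>2 * S + 32 * (cmod \<zeta>)\<^sup>2 * S \<le> M\<^sup>2"
      using S0 unfolding M2 by (simp_all add: algebra_simps)
  qed
  have p16: "(M / 4 ^ n)\<^sup>2 = M\<^sup>2 / 16 ^ n" for n
    by (simp add: power_divide power_mult[symmetric] mult.commute[of n 2] power_mult)
  have bounds: "sqnorm (y (Suc n)) \<le> (M / 4 ^ Suc n)\<^sup>2"
    "sqnorm (\<lambda>x. z0 *s y (Suc n) x + f (Suc n) x) \<le> (M / 4 ^ Suc n)\<^sup>2" for n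
  proof -
    have "sqnorm (y (Suc n)) \<le> S / 16 ^ Suc n" by (rule decay)
    also have "\<dots> \<le> M\<^sup>2 / 16 ^ Suc n" using MS by (intro divide_right_mono) auto
    finally show "sqnorm (y (Suc n)) \<le> (M / 4 ^ Suc n)\<^sup>2" by (simp only: p16)
    have "sqnorm (\<lambda>x. z0 *s y (Suc n) x + f (Suc n) x)
        \<le> 2 * ((cmod z0)\<^sup>2 * sqnorm (y (Suc n))) + 2 * ((cmod \<zeta>)\<^sup>2 * sqnorm (y n))"
      using square_integrable_add(2)[OF square_integrable_cscale(1)[OF sqy[of "Suc n"], of z0]
          square_integrable_cscale(1)[OF sqy[of n], of \<zeta>]]
      unfolding fSuc square_integrable_cscale(2)[OF sqy] .
    also have "\<dots> \<le> 2 * ((cmod z0)\<^sup>2 * (S / 16 ^ Suc n)) + 2 * ((cmod \<zeta>)\<^sup>2 * (S / 16 ^ n))"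
      by (intro add_mono mult_left_mono decay) auto
    also have "\<dots> = (2 * (cmod z0)\<^sup>2 * S + 32 * (cmod \<zeta>)\<^sup>2 * S) / 16 ^ Suc n"
      by (simp add: field_simps)
    also have "\<dots> \<le> M\<^sup>2 / 16 ^ Suc n" using MS by (intro divide_right_mono) auto
    finally show "sqnorm (\<lambda>x. z0 *s y (Suc n) x + f (Suc n) x) \<le> (M / 4 ^ Suc n)\<^sup>2" by (simp only: p16)
  qed
  have local_bound: "\<exists>B\<ge>0. \<forall>n. \<forall>x\<in>{- R..R}. norm (y n x) \<le> B / 4 ^ n" if R: "R \<ge> 0" for R
  proof -
    obtain K where K: "K \<ge> 0" "\<And>y h s x. (y, h) \<in> L \<Longrightarrow> s > 0 \<Longrightarrow> sqnorm y \<le> s\<^sup>2 \<Longrightarrow> sqnorm h \<le> s\<^sup>2 \<Longrightarrow>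
      x \<in> {- R..R} \<Longrightarrow> norm (y x) \<le> K * s" using L_pointwise_bound[OF R] by blast
    have "bounded (y 0 ` {- R..R})"
      using primitive_on_UNIV_continuous[OF py[of 0]]
      by (intro compact_imp_bounded compact_continuous_image) (auto intro: continuous_on_subset)
    then obtain B0 where B0: "\<And>x. x \<in> {- R..R} \<Longrightarrow> norm (y 0 x) \<le> B0"
      unfolding bounded_iff by (metis imageI)
    show ?thesis
    proof (intro exI conjI allI ballI)
      show "0 \<le> max (K * M) B0" using K M0 by (auto simp: le_max_iff_disj)
      fix n x assume x: "x \<in> {- R..R}"
      show "norm (y n x) \<le> max (K * M) B0 / 4 ^ n"
      proof (cases n)
        case 0
        then show ?thesis using B0[OF x] by simp
      next
        case (Suc m)
        have "norm (y (Suc m) x) \<le> K * (M / 4 ^ Suc m)"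
          by (rule K(2)[OF it _ bounds x]) (use M0 in simp)
        also have "\<dots> = K * M / 4 ^ Suc m" by simp
        also have "\<dots> \<le> max (K * M) B0 / 4 ^ Suc m" by (intro divide_right_mono) auto
        finally show ?thesis unfolding Suc .
      qed
    qed
  qed
  have pointwise_bound: "\<exists>B\<ge>0. \<forall>n. norm (y n x) \<le> B / 4 ^ n" for x
  proof -
    have "x \<in> {- \<bar>x\<bar>..\<bar>x\<bar>}" by auto
    then show ?thesis using local_bound[of "\<bar>x\<bar>"] abs_ge_zero[of x] by blast
  qed
  have geo: "summable (\<lambda>n. B / 4 ^ n :: real)" for B
    using summable_mult[OF summable_geometric[of "1/4 :: real"], of B] by (simp add: power_divide)
  have smn: "summable (\<lambda>n. norm (y n x))" for x
  proof -
    obtain B where "B \<ge> 0" "\<And>n. norm (y n x) \<le> B / 4 ^ n"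
      using pointwise_bound by blast
    then show ?thesis by (intro summable_comparison_test'[OF geo[of B]]) auto
  qed
  have sm: "summable (\<lambda>n. y n x)" for x using smn by (rule summable_norm_cancel)
  define T where "T n x = (\<Sum>k<n. y k x)" for n x
  define Y where "Y x = (\<Sum>n. y n x)" for x
  have TY: "(\<lambda>n. T n x) \<longlonglongrightarrow> Y x" for x
    unfolding T_def Y_def using sm by (rule summable_LIMSEQ)
  \<comment> \<open>The operator maps the partial sum with terms \<open>0, \<dots>, n\<close> to \<open>h n\<close>: the corrections telescope
    up to the shift between \<open>T (Suc n)\<close> and \<open>T n\<close>.\<close>
  define h where "h n x = z0 *s T (Suc n) x + \<zeta> *s T n x + g x" for n x
  define H where "H x = (z0 + \<zeta>) *s Y x + g x" for x
  have pT: "primitive_on UNIV (T (Suc n)) (rhs (T (Suc n)) (h n))" for n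
  proof (induction n)
    case 0
    show ?case
      by (rule primitive_on_cong[OF py[of 0]]) (auto simp: T_def h_def f0 vec_eq_iff forall_2)
  next
    case (Suc n)
    show ?case
      by (rule primitive_on_cong[OF dirac_solution_add[OF Suc py[of "Suc n"]]])
        (auto simp: T_def h_def fSuc vec_eq_iff forall_2 algebra_simps)
  qed
  have pY: "primitive_on UNIV Y (rhs Y H)"
    unfolding primitive_on_def
  proof (intro allI impI)
    fix a b :: real assume ab: "a \<le> b \<and> {a..b} \<subseteq> UNIV"
    define R where "R = max \<bar>a\<bar> \<bar>b\<bar>"
    obtain B0 where B0: "B0 \<ge> 0" "\<And>n x. x \<in> {- R..R} \<Longrightarrow> norm (y n x) \<le> B0 / 4 ^ n"
    proof -
      have "R \<ge> 0" by (simp add: R_def le_max_iff_disj)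
      from local_bound[OF this] show ?thesis using that by blast
    qed
    define B where "B = (\<Sum>n. B0 / 4 ^ n)"
    have TB: "norm (T n x) \<le> B" if "x \<in> {a..b}" for n x
    proof -
      have x: "x \<in> {- R..R}" using that by (auto simp: R_def)
      have "norm (T n x) \<le> (\<Sum>k<n. B0 / 4 ^ k)"
        unfolding T_def by (rule sum_norm_le) (use B0(2)[OF x] in auto)
      also have "\<dots> \<le> B" unfolding B_def
        by (rule sum_le_suminf[OF geo]) (use B0 in auto)
      finally show ?thesis .
    qed
    define q where "q x = pot x * B + (2 * ((cmod z0 + cmod \<zeta>) * B + 1) + 2 * (norm (g x))\<^sup>2)" for x
    have "(\<lambda>x. (norm (g x))\<^sup>2) absolutely_integrable_on UNIV"
      using sqg by (simp add: square_integrable_UNIV set_integrable_def)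
    then have gi: "(\<lambda>x. (norm (g x))\<^sup>2) integrable_on {a..b}"
      using absolutely_integrable_on_subinterval[where S = UNIV and a = a and b = b] by (fastforce simp: absolutely_integrable_on_def)
    have qi: "q integrable_on {a..b}"
      unfolding q_def by (intro integrable_add integrable_on_mult_left integrable_on_mult_right pot_integrable gi) auto
    have bd: "norm (rhs (T (Suc n)) (h n) x) \<le> q x" if x: "x \<in> {a..b}" for n x
    proof -
      have "norm (h n x) \<le> cmod z0 * norm (T (Suc n) x) + cmod \<zeta> * norm (T n x) + norm (g x)"
        unfolding h_def using norm_triangle_ineq[of "z0 *s T (Suc n) x + \<zeta> *s T n x" "g x"]
          norm_triangle_ineq[of "z0 *s T (Suc n) x" "\<zeta> *s T n x"] by (simp add: norm_cscale)
      also have "\<dots> \<le> cmod z0 * B + cmod \<zeta> * B + (1 + (norm (g x))\<^sup>2)"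
      proof (intro add_mono mult_left_mono TB x)
        have "2 * norm (g x) \<le> 1 + (norm (g x))\<^sup>2"
          using sum_squares_ge_zero[of "norm (g x) - 1" 0] by (simp add: power2_eq_square algebra_simps)
        then show "norm (g x) \<le> 1 + (norm (g x))\<^sup>2" using norm_ge_zero[of "g x"] by linarith
      qed auto
      finally have hb: "2 * norm (h n x) \<le> 2 * ((cmod z0 + cmod \<zeta>) * B + 1) + 2 * (norm (g x))\<^sup>2"
        by (simp add: algebra_simps)
      have "norm (rhs (T (Suc n)) (h n) x) \<le> pot x * norm (T (Suc n) x) + 2 * norm (h n x)"
        unfolding pot_def by (rule norm_dirac_rhs_le)
      also have "\<dots> \<le> q x" unfolding q_def
        by (intro add_mono mult_left_mono TB x hb pot_nonneg)
      finally show ?thesis .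
    qed
    have TS: "(\<lambda>n. T (Suc n) x) \<longlonglongrightarrow> Y x" for x using TY by (rule LIMSEQ_Suc)
    have hH: "(\<lambda>n. h n x) \<longlonglongrightarrow> H x" for x
    proof -
      have "(\<lambda>n. h n x) \<longlonglongrightarrow> z0 *s Y x + \<zeta> *s Y x + g x"
        unfolding h_def
        by (intro tendsto_add tendsto_const bounded_linear.tendsto[OF bounded_linear_cscale] TS TY)
      then show ?thesis by (simp add: H_def vector_sadd_rdistrib)
    qed
    have lim: "(\<lambda>n. rhs (T (Suc n)) (h n) x) \<longlonglongrightarrow> rhs Y H x" for x
    proof (rule vec_tendstoI)
      fix i :: 2
      have "(\<lambda>n. rhs (T (Suc n)) (h n) x $ 1) \<longlonglongrightarrow> rhs Y H x $ 1"
        "(\<lambda>n. rhs (T (Suc n)) (h n) x $ 2) \<longlonglongrightarrow> rhs Y H x $ 2"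
        unfolding dirac_rhs_nth by (intro tendsto_intros TS hH)+
      then show "(\<lambda>n. rhs (T (Suc n)) (h n) x $ i) \<longlonglongrightarrow> rhs Y H x $ i"
        using exhaust_2[of i] by auto
    qed
    have "(rhs Y H has_integral Y b - Y a) {a..b}"
    proof (rule has_integral_dominated_convergence[OF _ qi])
      show "(rhs (T (Suc n)) (h n) has_integral T (Suc n) b - T (Suc n) a) {a..b}" for n
        using primitive_onD(2)[OF pT] ab by auto
      show "(\<lambda>n. T (Suc n) b - T (Suc n) a) \<longlonglongrightarrow> Y b - Y a"
        by (intro tendsto_intros TS)
    qed (use bd lim in auto)
    moreover have "norm (rhs Y H x) \<le> q x" if "x \<in> {a..b}" for x
      by (rule LIMSEQ_le_const2[OF tendsto_norm[OF lim]]) (use bd[OF that] in auto)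
    ultimately show "rhs Y H absolutely_integrable_on {a..b} \<and> (rhs Y H has_integral Y b - Y a) {a..b}"
      using qi by (blast intro: absolutely_integrable_integrable_bound)
  qed
  have Ym: "Y \<in> borel_measurable lebesgue"
    using primitive_on_UNIV_continuous[OF pY]
    by (intro measurable_completion) (simp add: borel_measurable_continuous_onI)
  define w where "w k x = 2 ^ Suc k * (norm (y k x))\<^sup>2" for k x
  have wi: "integrable lebesgue (w k)" for k
    using sqy[of k] unfolding w_def by (auto simp: square_integrable_UNIV)
  have wint: "(\<integral>x. norm (w k x) \<partial>lebesgue) \<le> 2 * S / 8 ^ k" for k
  proof -
    have "(\<integral>x. norm (w k x) \<partial>lebesgue) = 2 ^ Suc k * sqnorm (y k)"
      by (simp add: w_def sqnorm_def)
    also have "\<dots> \<le> 2 ^ Suc k * (S / 16 ^ k)" by (intro mult_left_mono decay) auto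
    also have "\<dots> = 2 * S / 8 ^ k"
    proof -
      have "(16::real) ^ k = 2 ^ k * 8 ^ k" by (simp flip: power_mult_distrib)
      then show ?thesis by simp
    qed
    finally show ?thesis .
  qed
  have wsm: "summable (\<lambda>k. norm (w k x))" for x
  proof -
    obtain B where B: "B \<ge> 0" "\<And>n. norm (y n x) \<le> B / 4 ^ n"
      using pointwise_bound by blast
    have "norm (norm (w k x)) \<le> (2 * B\<^sup>2) / 4 ^ k" for k
    proof -
      have "(norm (y k x))\<^sup>2 \<le> (B / 4 ^ k)\<^sup>2" by (intro power_mono B) auto
      then have "w k x \<le> 2 ^ Suc k * (B / 4 ^ k)\<^sup>2" unfolding w_def by (intro mult_left_mono) auto
      also have "\<dots> = 2 * B\<^sup>2 * 2 ^ k / (4 ^ k * 4 ^ k)" by (simp add: power2_eq_square)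
      also have "\<dots> \<le> 2 * B\<^sup>2 * 4 ^ k / (4 ^ k * 4 ^ k)"
        by (intro divide_right_mono mult_left_mono power_mono) auto
      also have "\<dots> = (2 * B\<^sup>2) / 4 ^ k" by simp
      finally show ?thesis by (simp add: w_def)
    qed
    then show ?thesis by (intro summable_comparison_test'[OF geo[of "2 * B\<^sup>2"]])
  qed
  have "summable (\<lambda>k. \<integral>x. norm (w k x) \<partial>lebesgue)"
  proof (rule summable_comparison_test')
    show "summable (\<lambda>k. 2 * S / 8 ^ k :: real)"
      using summable_mult[OF summable_geometric[of "1/8 :: real"], of "2 * S"] by (simp add: power_divide)
    show "norm (\<integral>x. norm (w k x) \<partial>lebesgue) \<le> 2 * S / 8 ^ k" if "k \<ge> 0" for k
      using wint[of k] by simp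
  qed
  then have Wi: "integrable lebesgue (\<lambda>x. \<Sum>k. w k x)"
    using wi wsm by (intro integrable_suminf) auto
  have partial: "(norm (\<Sum>k<n. u k))\<^sup>2 \<le> (\<Sum>k<n. 2 ^ Suc k * (norm (u k))\<^sup>2)" for u :: "nat \<Rightarrow> complex ^ 2" and n
  proof (induction n arbitrary: u)
    case (Suc n)
    have "(norm (\<Sum>k<Suc n. u k))\<^sup>2 = (norm (u 0 + (\<Sum>k<n. u (Suc k))))\<^sup>2"
      by (simp add: sum.lessThan_Suc_shift del: sum.lessThan_Suc)
    also have "\<dots> \<le> 2 * (norm (u 0))\<^sup>2 + 2 * (norm (\<Sum>k<n. u (Suc k)))\<^sup>2"
      by (rule norm_add_squared_le)
    also have "\<dots> \<le> 2 * (norm (u 0))\<^sup>2 + 2 * (\<Sum>k<n. 2 ^ Suc k * (norm (u (Suc k)))\<^sup>2)"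
      using Suc[of "\<lambda>k. u (Suc k)"] by simp
    also have "\<dots> = (\<Sum>k<Suc n. 2 ^ Suc k * (norm (u k))\<^sup>2)"
      by (simp add: sum.lessThan_Suc_shift sum_distrib_left mult.assoc del: sum.lessThan_Suc)
    finally show ?case .
  qed simp
  have YW: "(norm (Y x))\<^sup>2 \<le> (\<Sum>k. w k x)" for x
  proof (rule LIMSEQ_le_const2)
    show "(\<lambda>n. (norm (T n x))\<^sup>2) \<longlonglongrightarrow> (norm (Y x))\<^sup>2" by (intro tendsto_intros TY)
    have "(norm (T n x))\<^sup>2 \<le> (\<Sum>k. w k x)" for n
    proof -
      have "(norm (T n x))\<^sup>2 \<le> (\<Sum>k<n. w k x)" unfolding T_def w_def by (rule partial)
      also have "\<dots> \<le> (\<Sum>k. w k x)"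
        by (rule sum_le_suminf[OF summable_norm_cancel[OF wsm]]) (auto simp: w_def)
      finally show ?thesis .
    qed
    then show "\<exists>N. \<forall>n\<ge>N. (norm (T n x))\<^sup>2 \<le> (\<Sum>k. w k x)" by blast
  qed
  have "integrable lebesgue (\<lambda>x. (norm (Y x))\<^sup>2)"
    by (rule Bochner_Integration.integrable_bound[OF Wi])
      (use Ym YW in \<open>auto intro!: AE_I2 intro: order_trans[OF _ abs_ge_self]\<close>)
  then have sqY: "square_integrable UNIV Y" using Ym by (simp add: square_integrable_UNIV)
  then have "square_integrable UNIV H"
    unfolding H_def using square_integrable_add(1) square_integrable_cscale(1) sqg by blast
  with sqY pY have "(Y, H) \<in> L" by (simp add: L_iff)
  then show ?thesis unfolding H_def by blast
qed

text \<open>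
  If \<open>C\<close> bounds the resolvent at \<open>z0\<close>, then for \<open>C * cmod (z - z0) < 1 / 4\<close> the bound survives with
  constant \<open>2 C\<close>, and the terms of the Neumann series shrink by the factor \<open>4\<close>, their squared norms by
  the factor \<open>16\<close>.
\<close>
lemma resolvent_set_open: "open (resolvent_set UNIV L)"
proof (rule openI)
  fix z0 assume z0: "z0 \<in> resolvent_set UNIV L"
  obtain C where C: "C > 0" "\<And>y h. (y, h) \<in> L \<Longrightarrow> sqnorm y \<le> C\<^sup>2 * sqnorm (\<lambda>x. h x - z0 *s y x)"
    using resolvent_setD[OF z0] by blast
  have "ball z0 (1 / (4 * C)) \<subseteq> resolvent_set UNIV L"
  proof
    fix z assume "z \<in> ball z0 (1 / (4 * C))"
    define \<zeta> where "\<zeta> = z - z0"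
    have "cmod \<zeta> < 1 / (4 * C)"
      using \<open>z \<in> ball z0 (1 / (4 * C))\<close> by (simp add: \<zeta>_def dist_norm norm_minus_commute)
    then have "C * cmod \<zeta> \<le> 1 / 4" using C(1) by (simp add: field_simps)
    then have "(C * cmod \<zeta>)\<^sup>2 \<le> (1 / 4)\<^sup>2" using C(1) by (intro power_mono) auto
    then have small: "C\<^sup>2 * (cmod \<zeta>)\<^sup>2 \<le> 1 / 16" by (simp add: power_mult_distrib power_divide)
    have est: "sqnorm y \<le> 4 * C\<^sup>2 * sqnorm (\<lambda>x. h x - z *s y x)" if yh: "(y, h) \<in> L" for y h
    proof -
      have sq: "square_integrable UNIV y" "square_integrable UNIV h" using yh by (auto simp: L_iff)
      have "sqnorm (\<lambda>x. h x - z0 *s y x) = sqnorm (\<lambda>x. (h x - z *s y x) + \<zeta> *s y x)"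
        by (simp add: \<zeta>_def vector_sub_rdistrib)
      also have "\<dots> \<le> 2 * sqnorm (\<lambda>x. h x - z *s y x) + 2 * ((cmod \<zeta>)\<^sup>2 * sqnorm y)"
        using square_integrable_add(2)[OF square_integrable_diff_cscale[OF sq(2,1), of z]
            square_integrable_cscale(1)[OF sq(1), of \<zeta>]]
        unfolding square_integrable_cscale(2)[OF sq(1)] .
      finally have "C\<^sup>2 * sqnorm (\<lambda>x. h x - z0 *s y x)
          \<le> C\<^sup>2 * (2 * sqnorm (\<lambda>x. h x - z *s y x) + 2 * ((cmod \<zeta>)\<^sup>2 * sqnorm y))"
        by (intro mult_left_mono) auto
      also have "\<dots> = 2 * (C\<^sup>2 * sqnorm (\<lambda>x. h x - z *s y x)) + 2 * ((C\<^sup>2 * (cmod \<zeta>)\<^sup>2) * sqnorm y)"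
        by (simp add: algebra_simps)
      also have "(C\<^sup>2 * (cmod \<zeta>)\<^sup>2) * sqnorm y \<le> 1 / 16 * sqnorm y"
        by (intro mult_right_mono small sqnorm_nonneg)
      finally have "sqnorm y \<le> 2 * (C\<^sup>2 * sqnorm (\<lambda>x. h x - z *s y x)) + 2 * (1 / 16 * sqnorm y)"
        using C(2)[OF yh] by simp
      moreover have "0 \<le> C\<^sup>2 * sqnorm (\<lambda>x. h x - z *s y x)" by (simp add: sqnorm_nonneg)
      ultimately show ?thesis by (simp add: mult.assoc)
    qed
    show "z \<in> resolvent_set UNIV L"
      unfolding resolvent_set_def lebesgue_on_UNIV_eq
    proof (intro CollectI conjI allI impI)
      fix g assume g: "square_integrable UNIV g"
      obtain R where R: "\<And>g. square_integrable UNIV g \<Longrightarrow> (R g, \<lambda>x. z0 *s R g x + g x) \<in> L"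
        using resolvent_set_solve[OF z0] by metis
      have R2: "sqnorm (R g) \<le> C\<^sup>2 * sqnorm g" if "square_integrable UNIV g" for g
        using C(2)[OF R[OF that]] by simp
      define f where "f = rec_nat g (\<lambda>_ r. (\<lambda>x. \<zeta> *s R r x))"
      have f: "f 0 = g" "f (Suc n) = (\<lambda>x. \<zeta> *s R (f n) x)" for n by (simp_all add: f_def)
      have sqf: "square_integrable UNIV (f n)" for n
      proof (induction n)
        case (Suc n)
        then have "square_integrable UNIV (R (f n))" using R[of "f n"] by (simp add: L_iff)
        then show ?case by (simp add: f square_integrable_cscale(1))
      qed (simp add: f g)
      have "sqnorm (R (f n)) \<le> sqnorm (R (f 0)) / 16 ^ n" for n
      proof (induction n)
        case (Suc n)
        have sqR: "square_integrable UNIV (R (f n))" using R[OF sqf[of n]] by (simp add: L_iff)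
        have "sqnorm (R (f (Suc n))) \<le> C\<^sup>2 * ((cmod \<zeta>)\<^sup>2 * sqnorm (R (f n)))"
          using R2[OF sqf[of "Suc n"]] square_integrable_cscale(2)[OF sqR] by (simp add: f)
        also have "\<dots> \<le> 1 / 16 * sqnorm (R (f n))"
          using mult_right_mono[OF small sqnorm_nonneg[of "R (f n)"]] by (simp add: mult.assoc)
        also have "\<dots> \<le> 1 / 16 * (sqnorm (R (f 0)) / 16 ^ n)" using Suc by simp
        finally show ?case by simp
      qed simp
      from geometric_correction_series[of "\<lambda>n. R (f n)", OF R[OF sqf] f this]
      obtain Y where Y: "(Y, \<lambda>x. (z0 + \<zeta>) *s Y x + g x) \<in> L" by blast
      show "\<exists>!y. \<exists>h. (y, h) \<in> L \<and> (AE x in lebesgue. h x - z *s y x = g x)"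
      proof (rule ex_ex1I)
        show "\<exists>y h. (y, h) \<in> L \<and> (AE x in lebesgue. h x - z *s y x = g x)"
          using Y by (intro exI[of _ Y] exI[of _ "\<lambda>x. (z0 + \<zeta>) *s Y x + g x"]) (simp add: \<zeta>_def)
      next
        fix y1 y2
        assume "\<exists>h. (y1, h) \<in> L \<and> (AE x in lebesgue. h x - z *s y1 x = g x)"
          "\<exists>h. (y2, h) \<in> L \<and> (AE x in lebesgue. h x - z *s y2 x = g x)"
        then obtain h1 h2 where h1: "(y1, h1) \<in> L" "AE x in lebesgue. h1 x - z *s y1 x = g x"
          and h2: "(y2, h2) \<in> L" "AE x in lebesgue. h2 x - z *s y2 x = g x" by blast
        define d where "d x = y1 x + (-1) *s y2 x" for x
        define h where "h x = h1 x + (-1) *s h2 x" for x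
        have dh: "(d, h) \<in> L"
          using dirac_op_add[OF h1(1)[unfolded dirac_L_def] dirac_op_cscale[OF h2(1)[unfolded dirac_L_def], of "-1"]]
          unfolding dirac_L_def d_def h_def .
        have ae: "AE x in lebesgue. h x = z *s d x"
          using h1(2) h2(2)
        proof eventually_elim
          case (elim x)
          then have "h1 x = g x + z *s y1 x" "h2 x = g x + z *s y2 x" by (auto simp: algebra_simps)
          then show ?case by (simp add: h_def d_def vec_eq_iff algebra_simps)
        qed
        have "sqnorm (\<lambda>x. h x - z *s d x) = (\<integral>x. 0 \<partial>(lebesgue :: real measure))"
          unfolding sqnorm_def
        proof (rule integral_cong_AE)
          have "square_integrable UNIV (\<lambda>x. h x - z *s d x)"
            using dh by (auto simp: L_iff intro: square_integrable_diff_cscale)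
          then show "(\<lambda>x. (norm (h x - z *s d x))\<^sup>2) \<in> borel_measurable lebesgue"
            by (auto simp: square_integrable_UNIV)
          show "AE x in lebesgue. (norm (h x - z *s d x))\<^sup>2 = 0"
            using ae by eventually_elim simp
        qed simp
        then have "sqnorm d = 0" using est[OF dh] sqnorm_nonneg[of d] by simp
        then have "d = 0" using L_kernel_trivial[OF z0 dh _ ae] by simp
        then show "y1 = y2" by (auto simp: d_def fun_eq_iff zero_fun_def)
      qed
    next
      show "\<exists>C. \<forall>(y, h)\<in>L. L2norm UNIV y \<le> C * L2norm UNIV (h - cscale z y)"
      proof (intro exI[of _ "2 * C"] ballI, clarify)
        fix y h assume "(y, h) \<in> L"
        then have "sqrt (sqnorm y) \<le> sqrt (4 * C\<^sup>2 * sqnorm (\<lambda>x. h x - z *s y x))"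
          using est by simp
        also have "\<dots> = 2 * C * sqrt (sqnorm (\<lambda>x. h x - z *s y x))"
          using C(1) by (simp add: real_sqrt_mult)
        finally show "L2norm UNIV y \<le> 2 * C * L2norm UNIV (h - cscale z y)"
          by (simp add: L2norm_UNIV cscale_def fun_diff_def)
      qed
    qed
  qed
  moreover have "1 / (4 * C) > 0" using C(1) by simp
  ultimately show "\<exists>e>0. ball z0 e \<subseteq> resolvent_set UNIV L" by blast
qed

lemma spectrum_closed: "closed (spectrum UNIV L)"
  using resolvent_set_open by (simp add: spectrum_def closed_def)

end

section \<open>Bands of spectrum and their density\<close>

text \<open>
  The lower bound is the upper bound for \<open>x \<mapsto> - F (- x)\<close> and \<open>t \<mapsto> - c (- t)\<close>: reversing both the
  line and the values preserves the monotonicity of the level.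
\<close>
lemma unique_level_point_abs_bound_decreasing:
  fixes F c :: "real \<Rightarrow> real"
  assumes F: "continuous_on UNIV F" and c: "continuous_on UNIV c"
    and mono: "\<And>s t. a \<le> s \<Longrightarrow> s < t \<Longrightarrow> t \<le> b \<Longrightarrow> c t < c s"
    and M: "\<And>t. \<bar>c t\<bar> \<le> M"
    and e: "e > 0"
    and uniq: "\<And>t. t \<in> {a..b} \<Longrightarrow> \<exists>!x. x \<in> {t - e<..<t + e} \<and> F x = c t"
    and x0: "a + e \<le> x0" "x0 \<le> b - e"
  shows "\<bar>F x0\<bar> \<le> M"
proof -
  have "F x0 \<le> c a" by (rule unique_level_point_bound[OF F c mono e uniq x0])
  moreover have "- F (- (- x0)) \<le> - c (- (- b))"
  proof (rule unique_level_point_bound[where c = "\<lambda>t. - c (- t)" and F = "\<lambda>x. - F (- x)" and b = "- a" and e = e])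
    show "continuous_on UNIV (\<lambda>x. - F (- x))" "continuous_on UNIV (\<lambda>x. - c (- x))"
      by (intro continuous_intros continuous_on_compose2[OF F] continuous_on_compose2[OF c]; simp)+
    fix t assume t: "t \<in> {- b..- a}"
    obtain x where x: "x \<in> {- t - e<..<- t + e}" "F x = c (- t)"
      and ux: "\<And>y. y \<in> {- t - e<..<- t + e} \<Longrightarrow> F y = c (- t) \<Longrightarrow> y = x"
      using uniq[of "- t"] t by auto
    show "\<exists>!x. x \<in> {t - e<..<t + e} \<and> - F (- x) = - c (- t)"
    proof (rule ex1I[of _ "- x"])
      fix y assume y: "y \<in> {t - e<..<t + e} \<and> - F (- y) = - c (- t)"
      have "- y = x" by (rule ux) (use y in auto)
      then show "y = - x" by simp
    qed (use x in auto)
  qed (use mono e x0 in auto)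
  ultimately show ?thesis using M[of a] M[of b] by (simp add: abs_le_iff)
qed

lemma unique_level_point_abs_bound_increasing:
  fixes F c :: "real \<Rightarrow> real"
  assumes F: "continuous_on UNIV F" and c: "continuous_on UNIV c"
    and mono: "\<And>s t. a \<le> s \<Longrightarrow> s < t \<Longrightarrow> t \<le> b \<Longrightarrow> c s < c t"
    and M: "\<And>t. \<bar>c t\<bar> \<le> M"
    and e: "e > 0"
    and uniq: "\<And>t. t \<in> {a..b} \<Longrightarrow> \<exists>!x. x \<in> {t - e<..<t + e} \<and> F x = c t"
    and x0: "a + e \<le> x0" "x0 \<le> b - e"
  shows "\<bar>F x0\<bar> \<le> M"
  using unique_level_point_abs_bound_decreasing[of "\<lambda>x. - F x" "\<lambda>t. - c t" a b M e x0]
    assms by (auto intro!: continuous_intros)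

context dirac_pt_symmetric
begin

text \<open>The discriminant on the real axis, where it is real-valued by \<open>discr_real\<close>.\<close>
definition lyapunov :: "real \<Rightarrow> real" where
  "lyapunov x = Re (discr (of_real x))"

lemma continuous_lyapunov: "continuous_on UNIV lyapunov"
  unfolding lyapunov_def continuous_on_eq_continuous_at[OF open_UNIV]
  by (intro ballI isCont_Re isCont_o2[OF _ isCont_discr]) (intro continuous_intros)

text \<open>
  Both the disc and, by \<open>discr_cnj\<close>, the set of eigenvalues are invariant under conjugation, so the only
  eigenvalue in the disc is real.
\<close>
lemma unique_eigenvalue_imp_unique_level:
  assumes "unique_simple_eigenvalue_in (dirac_Lt t (Pmat p2 p3)) (ball (of_real c) e)"
  shows "\<exists>!x. x \<in> {c - e<..<c + e} \<and> lyapunov x = 2 * cos (pi * t)"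
proof -
  obtain z where z: "{w \<in> ball (of_real c) e. discr w = of_real (2 * cos (pi * t))} = {z}"
    using assms unfolding unique_simple_eigenvalue_in_def eigenvalue_iff_discr by blast
  then have zb: "dist (of_real c) z < e" "discr z = of_real (2 * cos (pi * t))" by auto
  have "cmod (of_real c - cnj z) = cmod (cnj (of_real c - z))" by simp
  also have "\<dots> = cmod (of_real c - z)" by (rule complex_mod_cnj)
  finally have "cnj z \<in> ball (of_real c) e" using zb by (simp add: dist_norm)
  moreover have "discr (cnj z) = of_real (2 * cos (pi * t))" using zb by (simp add: discr_cnj)
  ultimately have "cnj z = z" using z by auto
  then obtain x where x: "z = of_real x" by (metis Reals_cases Reals_cnj_iff)
  have lev: "y \<in> {c - e<..<c + e} \<and> lyapunov y = 2 * cos (pi * t) \<longleftrightarrow>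
      of_real y \<in> {w \<in> ball (complex_of_real c) e. discr w = of_real (2 * cos (pi * t))}" for y
  proof -
    have "dist (complex_of_real c) (of_real y) < e \<longleftrightarrow> y \<in> {c - e<..<c + e}"
      by (auto simp: dist_of_real dist_real_def)
    moreover have "discr (of_real y) = of_real (2 * cos (pi * t)) \<longleftrightarrow> lyapunov y = 2 * cos (pi * t)"
      by (subst discr_real) (simp only: lyapunov_def of_real_eq_iff)
    ultimately show ?thesis by auto
  qed
  show ?thesis unfolding lev z x by auto
qed

lemma real_band_in_spectrum:
  assumes "\<bar>lyapunov x\<bar> \<le> 2"
  shows "of_real x \<in> spectrum UNIV (dirac_L (Pmat p2 p3))"
  using discr_in_band_spectrum[OF discr_real] assms by (simp add: lyapunov_def)

lemma unique_eigenvalues_imp_intervals_in_spectrum: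
  fixes c :: real
  assumes e: "e > 0" and c: "c = 2 * of_int k"
    and uniq: "\<And>t. t \<in> {e..1 - e} \<union> {1 + e..2 - e} \<Longrightarrow>
      unique_simple_eigenvalue_in (dirac_Lt t (Pmat p2 p3)) (ball (of_real (c + t)) e)"
  shows "x \<in> {c + 2 * e..c + 1 - 2 * e} \<union> {c + 1 + 2 * e..c + 2 - 2 * e} \<Longrightarrow>
    of_real x \<in> spectrum UNIV (dirac_L (Pmat p2 p3))"
proof -
  assume x: "x \<in> {c + 2 * e..c + 1 - 2 * e} \<union> {c + 1 + 2 * e..c + 2 - 2 * e}"
  let ?F = "\<lambda>x. lyapunov (c + x)"
  let ?c = "\<lambda>t. 2 * cos (pi * t)"
  have F: "continuous_on UNIV ?F"
    by (rule continuous_on_compose2[OF continuous_lyapunov]) (auto intro!: continuous_intros)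
  have cc: "continuous_on UNIV ?c" by (intro continuous_intros)
  have level: "\<exists>!x. x \<in> {t - e<..<t + e} \<and> ?F x = ?c t" if t: "t \<in> {e..1 - e} \<union> {1 + e..2 - e}" for t
  proof -
    obtain y where y: "y \<in> {c + t - e<..<c + t + e}" "lyapunov y = ?c t"
      and uy: "\<And>w. w \<in> {c + t - e<..<c + t + e} \<Longrightarrow> lyapunov w = ?c t \<Longrightarrow> w = y"
      using unique_eigenvalue_imp_unique_level[OF uniq[OF t]] by blast
    show ?thesis
    proof (rule ex1I[of _ "y - c"])
      fix w assume w: "w \<in> {t - e<..<t + e} \<and> ?F w = ?c t"
      have "c + w = y" by (rule uy) (use w in auto)
      then show "w = y - c" by simp
    qed (use y in auto)
  qed
  have M: "\<bar>?c t\<bar> \<le> 2" for t by (simp add: abs_mult)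
  have "\<bar>?F (x - c)\<bar> \<le> 2" using x
  proof
    assume x: "x \<in> {c + 2 * e..c + 1 - 2 * e}"
    show ?thesis
    proof (rule unique_level_point_abs_bound_decreasing[OF F cc _ M e])
      show "?c t < ?c s" if "e \<le> s" "s < t" "t \<le> 1 - e" for s t
        using that e by (simp add: cos_monotone_0_pi)
    qed (use x level in auto)
  next
    assume x: "x \<in> {c + 1 + 2 * e..c + 2 - 2 * e}"
    show ?thesis
    proof (rule unique_level_point_abs_bound_increasing[OF F cc _ M e])
      show "?c s < ?c t" if "1 + e \<le> s" "s < t" "t \<le> 2 - e" for s t
      proof -
        have "cos (pi * (2 - s)) < cos (pi * (2 - t))"
          using that e by (intro cos_monotone_0_pi) auto
        then show ?thesis by (simp add: right_diff_distrib cos_diff mult.commute[of pi 2])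
      qed
    qed (use x level in auto)
  qed
  then show ?thesis by (intro real_band_in_spectrum) simp
qed

end

text \<open>
  Once \<open>\<bar>k\<bar> \<ge> K\<close>, where \<open>e k < \<eta>\<close>, a point of \<open>[2k, 2k + 2]\<close> outside \<open>S\<close> is within \<open>2 \<eta>\<close> of an integer.
  So the part of \<open>(- 2s, 2s)\<close> missed by \<open>S\<close> is covered by a fixed bounded interval and at most
  \<open>4s + 5\<close> intervals of length \<open>4 \<eta>\<close>; relative to \<open>4s\<close> this is asymptotically at most \<open>4 \<eta>\<close>.
\<close>
lemma density_one_of_shrinking_gaps:
  fixes S :: "real set" and e :: "int \<Rightarrow> real" and N :: real
  assumes S: "S \<in> sets lebesgue"
    and e: "(e \<longlongrightarrow> 0) (filtercomap abs at_top)"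
    and sub: "\<And>k. of_int \<bar>k\<bar> > N \<Longrightarrow> {2 * of_int k + 2 * e k..2 * of_int k + 1 - 2 * e k}
      \<union> {2 * of_int k + 1 + 2 * e k..2 * of_int k + 2 - 2 * e k} \<subseteq> S"
  shows "((\<lambda>s. measure lebesgue (S \<inter> {- 2 * s<..<2 * s}) / (4 * s)) \<longlongrightarrow> 1) at_top"
proof (rule order_tendstoI)
  fix r :: real assume "1 < r"
  have "measure lebesgue (S \<inter> {- 2 * s<..<2 * s}) / (4 * s) < r" if s: "s > 0" for s
  proof -
    have "measure lebesgue (S \<inter> {- 2 * s<..<2 * s}) \<le> measure lebesgue {- 2 * s<..<2 * s}"
      using S by (intro measure_mono_fmeasurable) auto
    also have "\<dots> = 4 * s" using s by simp
    finally have "measure lebesgue (S \<inter> {- 2 * s<..<2 * s}) / (4 * s) \<le> 1" using s by simp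
    with \<open>1 < r\<close> show ?thesis by simp
  qed
  then show "\<forall>\<^sub>F s in at_top. measure lebesgue (S \<inter> {- 2 * s<..<2 * s}) / (4 * s) < r"
    using eventually_gt_at_top[of 0] by (rule eventually_mono[rotated])
next
  fix r :: real assume r: "r < 1"
  \<comment> \<open>so that the limiting loss \<open>4 \<eta>\<close> is half of the admissible \<open>1 - r\<close>\<close>
  define \<eta> where "\<eta> = (1 - r) / 8"
  have \<eta>: "\<eta> > 0" using r by (simp add: \<eta>_def)
  have "\<forall>\<^sub>F k in filtercomap abs at_top. e k < \<eta>" using e \<eta> by (rule order_tendstoD(2))
  then obtain K0 where K0: "\<And>k. \<bar>k\<bar> \<ge> K0 \<Longrightarrow> e k < \<eta>"
    by (auto simp: eventually_filtercomap eventually_at_top_linorder)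
  define K where "K = max K0 (max 0 (\<lfloor>N\<rfloor> + 1))"
  have K: "e k < \<eta>" "of_int \<bar>k\<bar> > N" if "\<bar>k\<bar> \<ge> K" for k
  proof -
    show "e k < \<eta>" using that by (intro K0) (simp add: K_def)
    have "\<lfloor>N\<rfloor> < \<bar>k\<bar>" using that by (simp add: K_def)
    then show "of_int \<bar>k\<bar> > N" by (simp add: floor_less_iff)
  qed
  have K_nonneg: "K \<ge> 0" by (simp add: K_def)
  define c :: real where "c = 2 * of_int K + 2"
  have lower: "4 * s - 2 * c - (4 * s + 5) * (4 * \<eta>) \<le> measure lebesgue (S \<inter> {- 2 * s<..<2 * s})"
    if s: "s > 0" for s
  proof -
    define M where "M = \<lfloor>2 * s\<rfloor> + 2"
    define G where "G m = {real_of_int m - 2 * \<eta>..of_int m + 2 * \<eta>}" for m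
    have "{- 2 * s<..<2 * s} \<subseteq> (S \<inter> {- 2 * s<..<2 * s}) \<union> ({- c..c} \<union> (\<Union>m\<in>{- M..M}. G m))"
    proof
      fix x assume x: "x \<in> {- 2 * s<..<2 * s}"
      define k where "k = \<lfloor>x / 2\<rfloor>"
      have k: "2 * of_int k \<le> x" "x < 2 * of_int k + 2"
        using floor_correct[of "x / 2"] unfolding k_def by linarith+
      have kM: "m \<in> {- M..M}" if "m \<in> {2 * k, 2 * k + 1, 2 * k + 2}" for m
      proof -
        have "of_int m < 2 * s + 3" "- 2 * s - 3 < of_int m" using that k x by auto
        then have "of_int (2 * k) < 2 * s" "- 2 * s - 2 < real_of_int (2 * k)" using k x by auto
        then have "2 * k \<le> \<lfloor>2 * s\<rfloor>" "- (2 * k) - 2 \<le> \<lfloor>2 * s\<rfloor>"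
          by (simp_all add: le_floor_iff)
        then show ?thesis using that by (auto simp: M_def)
      qed
      show "x \<in> (S \<inter> {- 2 * s<..<2 * s}) \<union> ({- c..c} \<union> (\<Union>m\<in>{- M..M}. G m))"
      proof (cases "\<bar>k\<bar> \<ge> K")
        case False
        then have "real_of_int k \<le> of_int K" "- of_int K \<le> real_of_int k" by linarith+
        then have "x \<in> {- c..c}" using k by (simp add: c_def)
        then show ?thesis by blast
      next
        case True
        show ?thesis
        proof (cases "x \<in> S")
          case False
          then have "x \<notin> {2 * of_int k + 2 * e k..2 * of_int k + 1 - 2 * e k}"
            "x \<notin> {2 * of_int k + 1 + 2 * e k..2 * of_int k + 2 - 2 * e k}"
            using sub[OF K(2)[OF True]] by blast+
          then have "x \<in> G (2 * k) \<or> x \<in> G (2 * k + 1) \<or> x \<in> G (2 * k + 2)"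
            using k K(1)[OF True] \<eta> by (auto simp: G_def)
          then show ?thesis using kM by blast
        qed (use x in blast)
      qed
    qed
    then have "measure lebesgue {- 2 * s<..<2 * s} \<le>
        measure lebesgue ((S \<inter> {- 2 * s<..<2 * s}) \<union> ({- c..c} \<union> (\<Union>m\<in>{- M..M}. G m)))"
    proof (rule measure_mono_fmeasurable)
      have "S \<inter> {- 2 * s<..<2 * s} \<in> lmeasurable"
        using fmeasurable_Int_fmeasurable[of "{- 2 * s<..<2 * s}" lebesgue S] S by (simp add: Int_commute)
      moreover have "{- c..c} \<union> (\<Union>m\<in>{- M..M}. G m) \<in> lmeasurable"
        by (auto simp: G_def intro!: fmeasurable.Un fmeasurable.finite_UN)
      ultimately show "(S \<inter> {- 2 * s<..<2 * s}) \<union> ({- c..c} \<union> (\<Union>m\<in>{- M..M}. G m)) \<in> lmeasurable"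
        by (rule fmeasurable.Un)
    qed auto
    also have "\<dots> \<le> measure lebesgue (S \<inter> {- 2 * s<..<2 * s}) + measure lebesgue ({- c..c} \<union> (\<Union>m\<in>{- M..M}. G m))"
      using S by (intro measure_Un_le) (auto simp: G_def)
    also have "measure lebesgue ({- c..c} \<union> (\<Union>m\<in>{- M..M}. G m))
        \<le> measure lebesgue {- c..c} + measure lebesgue (\<Union>m\<in>{- M..M}. G m)"
      by (intro measure_Un_le) (auto simp: G_def)
    also have "measure lebesgue (\<Union>m\<in>{- M..M}. G m) \<le> (\<Sum>m\<in>{- M..M}. measure lebesgue (G m))"
      by (intro measure_UNION_le) (auto simp: G_def)
    also have "\<dots> = real (card {- M..M}) * (4 * \<eta>)" using \<eta> by (simp add: G_def)
    also have "\<dots> \<le> (4 * s + 5) * (4 * \<eta>)"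
    proof (intro mult_right_mono)
      have "M \<ge> 0" using s by (simp add: M_def)
      then have "real (card {- M..M}) = 2 * of_int M + 1" by simp
      also have "\<dots> \<le> 4 * s + 5" unfolding M_def by (simp add: algebra_simps)
      finally show "real (card {- M..M}) \<le> 4 * s + 5" .
    qed (use \<eta> in simp)
    also have "measure lebesgue {- c..c} = 2 * c" using K_nonneg by (simp add: c_def)
    also have "measure lebesgue {- 2 * s<..<2 * s} = 4 * s" using s by simp
    finally show ?thesis by linarith
  qed
  have "r < measure lebesgue (S \<inter> {- 2 * s<..<2 * s}) / (4 * s)"
    if s: "s > max 0 ((2 * c + 20 * \<eta>) / (2 * (1 - r)))" for s
  proof -
    have s0: "s > 0" and s1: "(2 * c + 20 * \<eta>) / (2 * (1 - r)) < s" using s by auto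
    have "2 * c + 20 * \<eta> < s * (2 * (1 - r))" using s1 r by (simp add: pos_divide_less_eq)
    moreover have "(4 * s + 5) * (4 * \<eta>) = s * (2 * (1 - r)) + 20 * \<eta>"
    proof -
      have "1 - r = 8 * \<eta>" by (simp add: \<eta>_def)
      then have "s * (2 * (1 - r)) = s * (2 * (8 * \<eta>))" by (rule arg_cong)
      then show ?thesis by (simp add: algebra_simps)
    qed
    ultimately have "4 * s * r < measure lebesgue (S \<inter> {- 2 * s<..<2 * s})"
      using lower[OF s0] by (simp add: algebra_simps)
    then show ?thesis using s0 by (simp add: pos_less_divide_eq mult.commute)
  qed
  then show "\<forall>\<^sub>F s in at_top. r < measure lebesgue (S \<inter> {- 2 * s<..<2 * s}) / (4 * s)"
    using eventually_gt_at_top by (rule eventually_mono[rotated])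
qed

theorem theorem4:
  fixes p2 p3 :: "real \<Rightarrow> complex"
    and E :: "real \<Rightarrow> complex \<Rightarrow> complex ^ 2 ^ 2"
    and \<epsilon> \<delta> :: "int \<Rightarrow> real"
    and N :: real
  assumes "\<And>x. p2 (x + pi) = p2 x" and "\<And>x. p3 (x + pi) = p3 x"
    and "locally_integrable p2" and "locally_integrable p3"
    and "\<And>x. cnj (p2 (- x)) = p2 x" and "\<And>x. cnj (p3 (- x)) = p3 x"
    and "fundamental_matrix (Pmat p2 p3) E"
    and "\<And>k. \<epsilon> k > 0" and "\<And>k. \<delta> k > 0"
    and "(\<epsilon> \<longlongrightarrow> 0) (filtercomap abs at_top)" and "(\<delta> \<longlongrightarrow> 0) (filtercomap abs at_top)"
    and "\<exists>K. \<forall>k. \<bar>k\<bar> > K \<longrightarrow>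
           9 / 2 * (\<epsilon> k)\<^sup>2 > \<delta> k \<and>
           (\<forall>t\<in>{0..<2}. \<forall>z. Re z \<in> {2 * of_int k..2 * of_int k + 2} \<and> \<bar>Im z\<bar> \<le> \<epsilon> k \<longrightarrow>
              cmod (remainder_f E t z) < \<delta> k)"
    and "N > 0"
    and "\<And>k t. \<lbrakk>of_int \<bar>k\<bar> > N; t \<in> {\<epsilon> k..1 - \<epsilon> k} \<union> {1 + \<epsilon> k..2 - \<epsilon> k}\<rbrakk> \<Longrightarrow>
           unique_simple_eigenvalue_in (dirac_Lt t (Pmat p2 p3)) (ball (of_real (2 * of_int k + t)) (\<epsilon> k)) \<and>
           unique_simple_eigenvalue_in (dirac_Lt t (Pmat p2 p3)) (ball (of_real (2 * of_int k - t)) (\<epsilon> k))"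
  shows "(\<forall>k. of_int \<bar>k\<bar> > N \<longrightarrow>
            complex_of_real ` {2 * of_int k + 2 * \<epsilon> k..2 * of_int k + 1 - 2 * \<epsilon> k}
              \<subseteq> spectrum UNIV (dirac_L (Pmat p2 p3)) \<and>
            complex_of_real ` {2 * of_int k + 1 + 2 * \<epsilon> k..2 * of_int k + 2 - 2 * \<epsilon> k}
              \<subseteq> spectrum UNIV (dirac_L (Pmat p2 p3))) \<and>
         ((\<lambda>s. measure lebesgue
                 {x. complex_of_real x \<in> spectrum UNIV (dirac_L (Pmat p2 p3)) \<and> x \<in> {- 2 * s<..<2 * s}}
               / (4 * s)) \<longlongrightarrow> 1) at_top"
proof -
  interpret dirac_pt_symmetric p2 p3 E
    by unfold_locales (use assms(1-7) in auto)
  let ?\<sigma> = "spectrum UNIV (dirac_L (Pmat p2 p3))"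
  let ?S = "{x. complex_of_real x \<in> ?\<sigma>}"
  have bands: "{2 * of_int k + 2 * \<epsilon> k..2 * of_int k + 1 - 2 * \<epsilon> k}
      \<union> {2 * of_int k + 1 + 2 * \<epsilon> k..2 * of_int k + 2 - 2 * \<epsilon> k} \<subseteq> ?S"
    if k: "of_int \<bar>k\<bar> > N" for k
  proof
    fix x assume x: "x \<in> {2 * of_int k + 2 * \<epsilon> k..2 * of_int k + 1 - 2 * \<epsilon> k}
      \<union> {2 * of_int k + 1 + 2 * \<epsilon> k..2 * of_int k + 2 - 2 * \<epsilon> k}"
    have "complex_of_real x \<in> ?\<sigma>"
    proof (rule unique_eigenvalues_imp_intervals_in_spectrum[OF _ refl _ x])
      show "\<epsilon> k > 0" by fact
      fix t assume "t \<in> {\<epsilon> k..1 - \<epsilon> k} \<union> {1 + \<epsilon> k..2 - \<epsilon> k}"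
      from assms(14)[OF k this]
      show "unique_simple_eigenvalue_in (dirac_Lt t (Pmat p2 p3)) (ball (of_real (2 * of_int k + t)) (\<epsilon> k))" ..
    qed
    then show "x \<in> ?S" by simp
  qed
  have "closed ?S"
    using continuous_closed_vimage[OF spectrum_closed, of complex_of_real] by (simp add: vimage_def)
  then have "?S \<in> sets lebesgue" by simp
  from density_one_of_shrinking_gaps[OF this assms(10) bands]
  have "((\<lambda>s. measure lebesgue {x. complex_of_real x \<in> ?\<sigma> \<and> x \<in> {- 2 * s<..<2 * s}} / (4 * s)) \<longlongrightarrow> 1) at_top"
    by (simp add: Int_def)
  with bands show ?thesis by blast
qed

end
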